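(* Let $\mathcal{G}$ be a connected, locally finite, vertex-transitive, infinite graph with a distinguished vertex $0$, let $H$ be a co-compact subgroup of $\mathrm{Aut}(\mathcal{G})$, and let $X\subseteq\mathrm{Lip}_0(\mathcal{G})$ be a pointwise closed $H$-invariant linear subspace. If $X\cap\mathrm{Lip}_0^\infty(\mathcal{G})$ is non-zero, then $\ell_\infty$ embeds isomorphically into $X$. In particular, $X$ is non-separable and $\mathcal{F}_X(\mathcal{G})$ contains a complemented copy of $\ell_1$.
   Context: Graphs $\mathcal{G}=(V_{\mathcal{G}},E_{\mathcal{G}})$ have symmetric edge sets $E_{\mathcal{G}}\subseteq V_{\mathcal{G}}^2$; $d$ is the graph metric. $\mathrm{Lip}_0(\mathcal{G})$ is the Banach space of Lipschitz functions $f:V_{\mathcal{G}}\to\mathbb{R}$ with $f(0)=0$, normed by the optimal Lipschitz constant. The gradient of $f$ is $\nabla f:E_{\mathcal{G}}\to\mathbb{R}$, $\nabla f((v,w))=f(w)-f(v)$, and $\mathrm{Lip}_0^\infty(\mathcal{G})=\{f\in\mathrm{Lip}_0(\mathcal{G}):\nabla f\in c_0(E_{\mathcal{G}})\}$. $\mathrm{Aut}(\mathcal{G})$ is the group of graph automorphisms with the topology of pointwise convergence on $V_{\mathcal{G}}$; a subgroup $H$ is co-compact if the quotient space $\mathrm{Aut}(\mathcal{G})/H$ (equivalently $H\backslash\mathrm{Aut}(\mathcal{G})$) is compact. For $h\in\mathrm{Aut}(\mathcal{G})$, $(h\cdot f)(x)=f(h^{-1}x)-f(h^{-1}0)$. A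 linear subspace $X\subseteq\mathrm{Lip}_0(\mathcal{G})$ is $H$-invariant if $h\cdot X=X$ for all $h\in H$. It is pointwise closed if it is closed in $\mathrm{Lip}_0(\mathcal{G})$ for pointwise convergence on $V_{\mathcal{G}}$. $\mathcal{F}(\mathcal{G})$ is the Lipschitz-free (Arens–Eells) space over $(V_{\mathcal{G}},d,0)$, the canonical predual of $\mathrm{Lip}_0(\mathcal{G})$ (with duality $\langle f,\delta(v)\rangle=f(v)$, where $\delta:V_{\mathcal{G}}\to\mathcal{F}(\mathcal{G})$ is the canonical isometric embedding with $\delta(0)=0$ and linearly dense range). $\mathcal{F}_X(\mathcal{G}):=\mathcal{F}(\mathcal{G})/X_\perp$, where $X_\perp=\{z\in\mathcal{F}(\mathcal{G}): f(z)=0\ \forall f\in X\}$; it is the canonical predual of $X$. *)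

theory Defs
  imports "HOL-Analysis.Analysis" "HOL-Algebra.Left_Coset"
begin

section \<open>Graphs\<close>

text \<open>
  A graph is given by its edge relation \<open>E\<close>; the vertex set is the whole (arbitrary) type \<open>'v\<close>.
\<close>

definition connected_graph :: "('v \<times> 'v) set \<Rightarrow> bool" where
  "connected_graph E \<longleftrightarrow> (\<forall>x y. (x, y) \<in> E\<^sup>*)"

definition locally_finite_graph :: "('v \<times> 'v) set \<Rightarrow> bool" where
  "locally_finite_graph E \<longleftrightarrow> (\<forall>v. finite (E `` {v}))"

text \<open>The graph metric; only meaningful for connected graphs.\<close>

definition gdist :: "('v \<times> 'v) set \<Rightarrow> 'v \<Rightarrow> 'v \<Rightarrow> nat" where
  "gdist E x y = (LEAST n. (x, y) \<in> E ^^ n)"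

definition graph_aut :: "('v \<times> 'v) set \<Rightarrow> ('v \<Rightarrow> 'v) set" where
  "graph_aut E = {g. bij g \<and> (\<forall>x y. (g x, g y) \<in> E \<longleftrightarrow> (x, y) \<in> E)}"

definition aut_group :: "('v \<times> 'v) set \<Rightarrow> ('v \<Rightarrow> 'v) monoid" where
  "aut_group E = \<lparr>carrier = graph_aut E, mult = (\<circ>), one = id\<rparr>"

definition vertex_transitive :: "('v \<times> 'v) set \<Rightarrow> bool" where
  "vertex_transitive E \<longleftrightarrow> (\<forall>x y. \<exists>g\<in>graph_aut E. g x = y)"

text \<open>Pointwise convergence, the vertex set being discrete.\<close>

definition aut_topology :: "('v \<times> 'v) set \<Rightarrow> ('v \<Rightarrow> 'v) topology" where
  "aut_topology E =
     subtopology (product_topology (\<lambda>_. discrete_topology UNIV) UNIV) (graph_aut E)"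

definition quotient_topology :: "'a topology \<Rightarrow> ('a \<Rightarrow> 'b) \<Rightarrow> 'b topology" where
  "quotient_topology T q =
     topology (\<lambda>U. U \<subseteq> q ` topspace T \<and> openin T {x \<in> topspace T. q x \<in> U})"

lemma openin_quotient_topology:
  "openin (quotient_topology T q) U \<longleftrightarrow>
     U \<subseteq> q ` topspace T \<and> openin T {x \<in> topspace T. q x \<in> U}"
proof -
  have int: "{x \<in> topspace T. q x \<in> S \<inter> U} =
      {x \<in> topspace T. q x \<in> S} \<inter> {x \<in> topspace T. q x \<in> U}" for S U
    by blast
  have un: "{x \<in> topspace T. q x \<in> \<Union>\<K>} = (\<Union>U\<in>\<K>. {x \<in> topspace T. q x \<in> U})" for \<K>
    by blast
  have "istopology (\<lambda>U. U \<subseteq> q ` topspace T \<and> openin T {x \<in> topspace T. q x \<in> U})"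
    unfolding istopology_def int un by blast
  then show ?thesis
    by (simp add: quotient_topology_def topology_inverse')
qed

lemma quotient_map_quotient_topology: "quotient_map T (quotient_topology T q) q"
proof -
  have "openin (quotient_topology T q) (q ` topspace T)"
    by (auto simp: openin_quotient_topology intro: openin_subopen[THEN iffD2])
  then have "topspace (quotient_topology T q) = q ` topspace T"
    by (metis openin_quotient_topology openin_subset openin_topspace subset_antisym)
  then show ?thesis
    by (auto simp: quotient_map_def openin_quotient_topology)
qed

text \<open>Co-compactness: the space of left cosets, with the quotient topology, is compact.\<close>

definition cocompact :: "('v \<times> 'v) set \<Rightarrow> ('v \<Rightarrow> 'v) set \<Rightarrow> bool" where
  "cocompact E H \<longleftrightarrow>
     compact_space (quotient_topology (aut_topology E) (\<lambda>g. g <#\<^bsub>aut_group E\<^esub> H))"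


section \<open>Normed spaces with explicit carrier\<close>

record 'a nspace =
  vecs :: "'a set"
  vzero :: 'a
  vadd :: "'a \<Rightarrow> 'a \<Rightarrow> 'a"
  vscale :: "real \<Rightarrow> 'a \<Rightarrow> 'a"
  vnorm :: "'a \<Rightarrow> real"

definition vdiff :: "'a nspace \<Rightarrow> 'a \<Rightarrow> 'a \<Rightarrow> 'a" where
  "vdiff A x y = vadd A x (vscale A (-1) y)"

definition linear_subspace :: "'a nspace \<Rightarrow> 'a set \<Rightarrow> bool" where
  "linear_subspace A Y \<longleftrightarrow> Y \<subseteq> vecs A \<and> vzero A \<in> Y \<and>
     (\<forall>x\<in>Y. \<forall>y\<in>Y. vadd A x y \<in> Y) \<and> (\<forall>c. \<forall>x\<in>Y. vscale A c x \<in> Y)"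

definition linear_op :: "'a nspace \<Rightarrow> 'b nspace \<Rightarrow> ('a \<Rightarrow> 'b) \<Rightarrow> bool" where
  "linear_op A B T \<longleftrightarrow> T \<in> vecs A \<rightarrow> vecs B \<and>
     (\<forall>x\<in>vecs A. \<forall>y\<in>vecs A. T (vadd A x y) = vadd B (T x) (T y)) \<and>
     (\<forall>c. \<forall>x\<in>vecs A. T (vscale A c x) = vscale B c (T x))"

definition bounded_op :: "'a nspace \<Rightarrow> 'b nspace \<Rightarrow> ('a \<Rightarrow> 'b) \<Rightarrow> bool" where
  "bounded_op A B T \<longleftrightarrow> linear_op A B T \<and>
     (\<exists>C. \<forall>x\<in>vecs A. vnorm B (T x) \<le> C * vnorm A x)"

definition iso_embedding :: "'a nspace \<Rightarrow> 'b nspace \<Rightarrow> ('a \<Rightarrow> 'b) \<Rightarrow> bool" where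
  "iso_embedding A B T \<longleftrightarrow> bounded_op A B T \<and>
     (\<exists>c>0. \<forall>x\<in>vecs A. c * vnorm A x \<le> vnorm B (T x))"

definition embeds_isomorphically :: "'a nspace \<Rightarrow> 'b nspace \<Rightarrow> bool" where
  "embeds_isomorphically A B \<longleftrightarrow> (\<exists>T. iso_embedding A B T)"

text \<open>\<open>B\<close> contains an isomorphic copy of \<open>A\<close> which is the range of a bounded projection on \<open>B\<close>.\<close>

definition contains_complemented_copy :: "'b nspace \<Rightarrow> 'a nspace \<Rightarrow> bool" where
  "contains_complemented_copy B A \<longleftrightarrow>
     (\<exists>T P. iso_embedding A B T \<and> bounded_op B B P \<and>
        (\<forall>y\<in>vecs B. P (P y) = P y) \<and> P ` vecs B = T ` vecs A)"

definition separable_nspace :: "'a nspace \<Rightarrow> bool" where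
  "separable_nspace A \<longleftrightarrow> (\<exists>D. countable D \<and> D \<subseteq> vecs A \<and>
     (\<forall>x\<in>vecs A. \<forall>\<epsilon>>0. \<exists>y\<in>D. vnorm A (vdiff A x y) < \<epsilon>))"

definition subspace_of :: "'a nspace \<Rightarrow> 'a set \<Rightarrow> 'a nspace" where
  "subspace_of A Y = A\<lparr>vecs := Y\<rparr>"

definition coset :: "'a nspace \<Rightarrow> 'a set \<Rightarrow> 'a \<Rightarrow> 'a set" where
  "coset A N x = vadd A x ` N"

text \<open>
  The quotient space. In the scalar multiplication \<open>N\<close> is added back so that \<open>0\<close> times a coset is
  the coset \<open>N\<close> rather than \<open>{0}\<close>.
\<close>

definition quotient_nspace :: "'a nspace \<Rightarrow> 'a set \<Rightarrow> 'a set nspace" where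
  "quotient_nspace A N =
     \<lparr>vecs = coset A N ` vecs A,
      vzero = N,
      vadd = (\<lambda>P Q. {vadd A x y | x y. x \<in> P \<and> y \<in> Q}),
      vscale = (\<lambda>c P. {vadd A (vscale A c x) n | x n. x \<in> P \<and> n \<in> N}),
      vnorm = (\<lambda>P. Inf (vnorm A ` P))\<rparr>"

text \<open>
  The dual space. To make functionals on \<open>vecs A\<close> unique as functions on the whole type, they are
  extended by \<open>0\<close> outside \<open>vecs A\<close>.
\<close>

definition dual_nspace :: "'a nspace \<Rightarrow> ('a \<Rightarrow> real) nspace" where
  "dual_nspace A =
     \<lparr>vecs = {\<phi>. (\<forall>x. x \<notin> vecs A \<longrightarrow> \<phi> x = 0) \<and>
        (\<forall>x\<in>vecs A. \<forall>y\<in>vecs A. \<phi> (vadd A x y) = \<phi> x + \<phi> y) \<and>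
        (\<forall>c. \<forall>x\<in>vecs A. \<phi> (vscale A c x) = c * \<phi> x) \<and>
        (\<exists>C. \<forall>x\<in>vecs A. \<bar>\<phi> x\<bar> \<le> C * vnorm A x)},
      vzero = (\<lambda>_. 0),
      vadd = (\<lambda>\<phi> \<psi> x. \<phi> x + \<psi> x),
      vscale = (\<lambda>c \<phi> x. c * \<phi> x),
      vnorm = (\<lambda>\<phi>. SUP x\<in>{x \<in> vecs A. vnorm A x \<le> 1}. \<bar>\<phi> x\<bar>)\<rparr>"

definition linf :: "(nat \<Rightarrow> real) nspace" where
  "linf =
     \<lparr>vecs = {x. bounded (range x)},
      vzero = (\<lambda>_. 0),
      vadd = (\<lambda>x y n. x n + y n),
      vscale = (\<lambda>c x n. c * x n),
      vnorm = (\<lambda>x. SUP n. \<bar>x n\<bar>)\<rparr>"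

definition l1 :: "(nat \<Rightarrow> real) nspace" where
  "l1 =
     \<lparr>vecs = {x. summable (\<lambda>n. \<bar>x n\<bar>)},
      vzero = (\<lambda>_. 0),
      vadd = (\<lambda>x y n. x n + y n),
      vscale = (\<lambda>c x n. c * x n),
      vnorm = (\<lambda>x. \<Sum>n. \<bar>x n\<bar>)\<rparr>"


section \<open>Lipschitz functions on a graph\<close>

definition lip_bound :: "('v \<times> 'v) set \<Rightarrow> ('v \<Rightarrow> real) \<Rightarrow> real \<Rightarrow> bool" where
  "lip_bound E f L \<longleftrightarrow> 0 \<le> L \<and> (\<forall>x y. \<bar>f x - f y\<bar> \<le> L * real (gdist E x y))"

text \<open>\<open>v0\<close> is the distinguished vertex; the norm is the optimal Lipschitz constant.\<close>

definition Lip0 :: "('v \<times> 'v) set \<Rightarrow> 'v \<Rightarrow> ('v \<Rightarrow> real) nspace" where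
  "Lip0 E v0 =
     \<lparr>vecs = {f. f v0 = 0 \<and> (\<exists>L. lip_bound E f L)},
      vzero = (\<lambda>_. 0),
      vadd = (\<lambda>f g x. f x + g x),
      vscale = (\<lambda>c f x. c * f x),
      vnorm = (\<lambda>f. Inf {L. lip_bound E f L})\<rparr>"

definition gradient :: "('v \<Rightarrow> real) \<Rightarrow> 'v \<times> 'v \<Rightarrow> real" where
  "gradient f = (\<lambda>(v, w). f w - f v)"

definition c0_on :: "'e set \<Rightarrow> ('e \<Rightarrow> real) \<Rightarrow> bool" where
  "c0_on S u \<longleftrightarrow> (\<forall>\<epsilon>>0. finite {e \<in> S. \<epsilon> \<le> \<bar>u e\<bar>})"

definition Lip0_inf :: "('v \<times> 'v) set \<Rightarrow> 'v \<Rightarrow> ('v \<Rightarrow> real) set" where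
  "Lip0_inf E v0 = {f \<in> vecs (Lip0 E v0). c0_on E (gradient f)}"

definition aut_act :: "'v \<Rightarrow> ('v \<Rightarrow> 'v) \<Rightarrow> ('v \<Rightarrow> real) \<Rightarrow> 'v \<Rightarrow> real" where
  "aut_act v0 h f = (\<lambda>x. f (inv_into UNIV h x) - f (inv_into UNIV h v0))"

definition invariant_under :: "'v \<Rightarrow> ('v \<Rightarrow> 'v) set \<Rightarrow> ('v \<Rightarrow> real) set \<Rightarrow> bool" where
  "invariant_under v0 H X \<longleftrightarrow> (\<forall>h\<in>H. aut_act v0 h ` X = X)"

text \<open>The topology on functions is the product topology, i.e. pointwise convergence.\<close>

definition pointwise_closed :: "('v \<times> 'v) set \<Rightarrow> 'v \<Rightarrow> ('v \<Rightarrow> real) set \<Rightarrow> bool" where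
  "pointwise_closed E v0 X \<longleftrightarrow> closedin (top_of_set (vecs (Lip0 E v0))) X"


section \<open>The Lipschitz-free space\<close>

definition eval_at :: "('v \<times> 'v) set \<Rightarrow> 'v \<Rightarrow> 'v \<Rightarrow> ('v \<Rightarrow> real) \<Rightarrow> real" where
  "eval_at E v0 v = (\<lambda>f. if f \<in> vecs (Lip0 E v0) then f v else 0)"

definition molecules :: "('v \<times> 'v) set \<Rightarrow> 'v \<Rightarrow> (('v \<Rightarrow> real) \<Rightarrow> real) set" where
  "molecules E v0 = {\<lambda>f. \<Sum>v\<in>S. a v * eval_at E v0 v f | S a. finite S}"

text \<open>
  The closed linear span of the evaluation functionals \<open>\<delta>(v) = eval_at E v0 v\<close> in the dual of
  \<open>Lip0 E v0\<close>. The duality between \<open>f\<close> in \<open>Lip0 E v0\<close> and \<open>z\<close> in the free space is \<open>z f\<close>.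
\<close>

definition free_space :: "('v \<times> 'v) set \<Rightarrow> 'v \<Rightarrow> (('v \<Rightarrow> real) \<Rightarrow> real) nspace" where
  "free_space E v0 =
     subspace_of (dual_nspace (Lip0 E v0))
       {z \<in> vecs (dual_nspace (Lip0 E v0)).
          \<forall>\<epsilon>>0. \<exists>m\<in>molecules E v0.
            vnorm (dual_nspace (Lip0 E v0)) (vdiff (dual_nspace (Lip0 E v0)) z m) < \<epsilon>}"

definition preannihilator ::
    "('v \<times> 'v) set \<Rightarrow> 'v \<Rightarrow> ('v \<Rightarrow> real) set \<Rightarrow> (('v \<Rightarrow> real) \<Rightarrow> real) set" where
  "preannihilator E v0 X = {z \<in> vecs (free_space E v0). \<forall>f\<in>X. z f = 0}"

definition free_space_mod ::
    "('v \<times> 'v) set \<Rightarrow> 'v \<Rightarrow> ('v \<Rightarrow> real) set \<Rightarrow> (('v \<Rightarrow> real) \<Rightarrow> real) set nspace" where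
  "free_space_mod E v0 X = quotient_nspace (free_space E v0) (preannihilator E v0 X)"

end

theory Submission
  imports Defs
begin

text \<open>
  Let \<open>f\<close> be a nonzero element of \<open>X\<close> whose gradient vanishes at infinity, scaled so that its
  gradient is 1 at some edge. Since \<open>H\<close> is co-compact, it has finitely many orbits on the infinite
  vertex set (\<open>cocompact_finitely_many_orbits\<close>), hence an infinite one, and for any two finite
  sets of vertices some \<open>h\<close> in \<open>H\<close> moves the first off the second
  (\<open>cocompact_displaces_finite_sets\<close>). The gradients of the translates \<open>h \<cdot> f\<close>
  can therefore be made small on any given finite set of edges, and a sliding hump argument (\<open>sliding_hump\<close>)
  selects translates \<open>f n\<close> with almost disjoint gradients: the sums \<open>\<Sum> \<bar>\<nabla>(f n)\<bar>\<close> are uniformly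
  bounded on the edges, and at the edge \<open>(x n, y n)\<close> where the gradient of \<open>f n\<close> is 1 those of the
  others add up to at most \<open>1/2\<close>.

  Thus \<open>b \<mapsto> \<Sum> b n * f n\<close>, summed pointwise, is a bounded map of \<open>\<ell>\<^sub>\<infinity>\<close> into the pointwise closed
  space \<open>X\<close>. Followed by \<open>g \<mapsto> (g (y n) - g (x n))\<^sub>n\<close> it gives an operator on \<open>\<ell>\<^sub>\<infinity>\<close> at distance at
  most \<open>1/2\<close> from the identity, hence an invertible one, and composing with the inverse yields
  a bounded linear \<open>W\<close> from \<open>\<ell>\<^sub>\<infinity>\<close> to \<open>X\<close> with \<open>W b (y n) - W b (x n) = b n\<close>
  (\<open>exists_gradient_interpolation\<close>).

  All three conclusions follow from \<open>W\<close>. It is bounded below, since gradients along edges are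
  bounded by the Lipschitz constant; so \<open>\<ell>\<^sub>\<infinity>\<close> embeds, and \<open>X\<close> contains the images of the
  uncountably many 0-1 sequences, which are uniformly separated. In the predual, \<open>T\<close> mapping \<open>a\<close> in
  \<open>\<ell>\<^sub>1\<close> to the class of \<open>\<Sum> a n * (\<delta>(y n) - \<delta>(x n))\<close> is bounded, and so is the map \<open>Q\<close> to \<open>\<ell>\<^sub>1\<close>
  evaluating a class at the functions \<open>W e\<^sub>i\<close>: with suitable signs, \<open>\<Sum> \<bar>z (W e\<^sub>i)\<bar>\<close> is a value of
  \<open>z\<close> on the \<open>W\<close>-image of the unit ball. As \<open>Q \<circ> T = id\<close>, the range of \<open>T\<close> is a copy of \<open>\<ell>\<^sub>1\<close> and
  \<open>T \<circ> Q\<close> projects onto it.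
\<close>

section \<open>Bounded combinations of absolutely summable sequences\<close>

lemma bounded_combination_of_abs_summable:
  fixes b k :: "nat \<Rightarrow> real"
  assumes k: "\<And>N. (\<Sum>j<N. \<bar>k j\<bar>) \<le> C" and b: "\<And>j. \<bar>b j\<bar> \<le> B"
  shows "summable (\<lambda>j. \<bar>b j * k j\<bar>)" and "summable (\<lambda>j. b j * k j)"
    and "\<bar>\<Sum>j. b j * k j\<bar> \<le> B * C"
proof -
  have B: "0 \<le> B" using b[of 0] by linarith
  have part: "(\<Sum>j<N. \<bar>b j * k j\<bar>) \<le> B * C" for N
  proof -
    have "(\<Sum>j<N. \<bar>b j * k j\<bar>) \<le> (\<Sum>j<N. B * \<bar>k j\<bar>)"
      by (intro sum_mono) (simp add: abs_mult b mult_right_mono)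
    also have "\<dots> \<le> B * C"
      using k[of N] B by (simp add: mult_left_mono flip: sum_distrib_left)
    finally show ?thesis .
  qed
  show s: "summable (\<lambda>j. \<bar>b j * k j\<bar>)"
    by (rule summableI_nonneg_bounded[OF _ part]) simp
  then show "summable (\<lambda>j. b j * k j)" by (rule summable_rabs_cancel)
  have "\<bar>\<Sum>j. b j * k j\<bar> \<le> (\<Sum>j. \<bar>b j * k j\<bar>)" by (rule summable_rabs[OF s])
  also have "\<dots> \<le> B * C" by (rule suminf_le_const[OF s part])
  finally show "\<bar>\<Sum>j. b j * k j\<bar> \<le> B * C" .
qed

text \<open>
  A matrix whose rows have \<open>\<ell>\<^sub>1\<close>-norm at most \<open>1/2\<close> is an operator of norm at most \<open>1/2\<close> on
  \<open>\<ell>\<^sub>\<infinity>\<close>. Hence its perturbation of the identity is bounded below by \<open>1/2\<close>, and it is onto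
  by the Neumann series \<open>b = c - K c + K\<^sup>2 c - \<dots>\<close>.
\<close>

lemma perturbed_identity_bounded_below:
  fixes K :: "nat \<Rightarrow> nat \<Rightarrow> real" and b c :: "nat \<Rightarrow> real"
  assumes K: "\<And>n N. (\<Sum>j<N. \<bar>K n j\<bar>) \<le> 1/2"
    and b: "bounded (range b)" and c: "\<And>n. \<bar>c n\<bar> \<le> B"
    and eq: "\<And>n. b n + (\<Sum>j. b j * K n j) = c n"
  shows "\<bar>b n\<bar> \<le> 2 * B"
proof -
  define s where "s = (SUP n. \<bar>b n\<bar>)"
  have "bdd_above (range (\<lambda>n. \<bar>b n\<bar>))"
    using b unfolding bounded_iff bdd_above_def by auto
  then have bs: "\<bar>b n\<bar> \<le> s" for n
    unfolding s_def by (intro cSUP_upper) auto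
  have "\<bar>b n\<bar> \<le> B + s * (1/2)" for n
    using eq[of n] c[of n] bounded_combination_of_abs_summable(3)[where b = b and B = s, OF K[of n] bs] by linarith
  then have "s \<le> B + s * (1/2)"
    unfolding s_def by (intro cSUP_least) auto
  with bs[of n] show ?thesis by linarith
qed

lemma perturbed_identity_surjective:
  fixes K :: "nat \<Rightarrow> nat \<Rightarrow> real" and c :: "nat \<Rightarrow> real"
  assumes K: "\<And>n N. (\<Sum>j<N. \<bar>K n j\<bar>) \<le> 1/2" and c: "\<And>n. \<bar>c n\<bar> \<le> B"
  obtains b where "bounded (range b)" "\<And>n. b n + (\<Sum>j. b j * K n j) = c n"
proof -
  note row = bounded_combination_of_abs_summable[OF K]
  define d where "d = rec_nat c (\<lambda>_ x n. - (\<Sum>j. x j * K n j))"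
  have d0: "d 0 = c" and dS: "d (Suc i) n = - (\<Sum>j. d i j * K n j)" for i n
    by (simp_all add: d_def)
  have B: "0 \<le> B" using c[of 0] by linarith
  have d_le: "\<bar>d i n\<bar> \<le> B * (1/2) ^ i" for i n
  proof (induction i arbitrary: n)
    case 0
    then show ?case by (simp add: d0 c)
  next
    case (Suc i)
    show ?case using row(3)[where b = "d i" and B = "B * (1/2) ^ i", OF Suc, of n] by (simp add: dS)
  qed
  have geo: "summable (\<lambda>i. B * (1/2) ^ i)" by (intro summable_mult summable_geometric) simp
  have d_abs: "summable (\<lambda>i. \<bar>d i n\<bar>)" for n
    by (rule summable_comparison_test'[OF geo]) (use d_le in auto)
  then have d_sum: "summable (\<lambda>i. d i n)" for n by (rule summable_rabs_cancel)
  define s where "s = (\<lambda>k n. \<Sum>i<k. d i n)"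
  define b where "b = (\<lambda>n. \<Sum>i. d i n)"
  \<comment> \<open>the error of the partial sums, uniform in the coordinate \<open>n\<close>\<close>
  have tail: "\<bar>b n - s k n\<bar> \<le> 2 * B * (1/2) ^ k" for n k
  proof -
    have bd: "\<bar>d (i + k) n\<bar> \<le> B * (1/2) ^ k * (1/2) ^ i" for i
      using d_le[of "i + k" n] by (simp add: power_add mult_ac)
    have g: "summable (\<lambda>i. B * (1/2) ^ k * (1/2) ^ i)" by (intro summable_mult summable_geometric) simp
    have da: "summable (\<lambda>i. \<bar>d (i + k) n\<bar>)"
      using d_abs[of n] by (subst summable_iff_shift)
    have "b n - s k n = (\<Sum>i. d (i + k) n)"
      using suminf_minus_initial_segment[OF d_sum[of n], of k] by (simp add: b_def s_def)
    also have "\<bar>\<dots>\<bar> \<le> (\<Sum>i. \<bar>d (i + k) n\<bar>)" by (rule summable_rabs[OF da])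
    also have "\<dots> \<le> (\<Sum>i. B * (1/2) ^ k * (1/2) ^ i)" by (rule suminf_le[OF bd da g])
    also have "\<dots> = 2 * B * (1/2) ^ k"
      by (subst suminf_mult[OF summable_geometric]) (simp_all add: suminf_geometric)
    finally show ?thesis .
  qed
  have b_le: "\<bar>b n\<bar> \<le> 2 * B" for n using tail[of n 0] by (simp add: s_def)
  have sum_row: "summable (\<lambda>j. d i j * K n j)" for i n
    by (rule row(2)[where B = "B * (1/2) ^ i", OF d_le])
  have s_row: "summable (\<lambda>j. s k j * K n j)" for k n
    unfolding s_def sum_distrib_right by (intro summable_sum sum_row)
  have rec: "s (Suc k) n + (\<Sum>j. s k j * K n j) = c n" for k n
  proof -
    have "(\<Sum>j. s k j * K n j) = (\<Sum>i<k. \<Sum>j. d i j * K n j)"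
      unfolding s_def sum_distrib_right by (rule suminf_sum) (rule sum_row)
    also have "\<dots> = - (\<Sum>i<k. d (Suc i) n)" by (simp add: dS sum_negf)
    finally show ?thesis by (simp add: s_def sum.lessThan_Suc_shift d0 del: sum.lessThan_Suc)
  qed
  have "b n + (\<Sum>j. b j * K n j) = c n" for n
  proof -
    define r where "r = b n + (\<Sum>j. b j * K n j) - c n"
    have "\<bar>r\<bar> \<le> 2 * B * (1/2) ^ k" for k
    proof -
      have "r = (b n - s (Suc k) n) + ((\<Sum>j. b j * K n j) - (\<Sum>j. s k j * K n j))"
        using rec[of k n] by (simp add: r_def)
      also have "(\<Sum>j. b j * K n j) - (\<Sum>j. s k j * K n j) = (\<Sum>j. (b j - s k j) * K n j)"
        by (subst suminf_diff[OF row(2)[OF b_le] s_row]) (simp add: left_diff_distrib)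
      finally show ?thesis
        using tail[of n "Suc k"] row(3)[where b = "\<lambda>j. b j - s k j", OF tail, of n] by simp
    qed
    moreover have "(\<lambda>k. 2 * B * (1/2) ^ k) \<longlonglongrightarrow> 2 * B * 0"
      by (intro tendsto_mult_left LIMSEQ_power_zero) simp
    ultimately have "\<bar>r\<bar> \<le> 0" by (intro LIMSEQ_le_const[of _ 0]) auto
    then show ?thesis by (simp add: r_def)
  qed
  moreover have "bounded (range b)" using b_le by (auto simp: bounded_iff)
  ultimately show thesis using that by blast
qed


section \<open>A sliding hump in families vanishing at infinity\<close>

text \<open>
  Later members are chosen small on the finite set where some earlier member is large, so at every
  point at least one member of each pair is small.
\<close>

lemma sliding_hump:
  fixes u :: "'h \<Rightarrow> 'e \<Rightarrow> real" and \<epsilon> :: "nat \<Rightarrow> real"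
  assumes c0: "\<And>h. h \<in> H \<Longrightarrow> c0_on S (u h)"
    and escape: "\<And>F \<delta>. finite F \<Longrightarrow> F \<subseteq> S \<Longrightarrow> 0 < \<delta> \<Longrightarrow> \<exists>h\<in>H. \<forall>e\<in>F. \<bar>u h e\<bar> < \<delta>"
    and \<epsilon>: "\<And>n. 0 < \<epsilon> n"
  obtains h :: "nat \<Rightarrow> 'h" where "\<And>n. h n \<in> H"
    and "\<And>j n e. j < n \<Longrightarrow> e \<in> S \<Longrightarrow> \<bar>u (h j) e\<bar> < \<epsilon> n \<or> \<bar>u (h n) e\<bar> < \<epsilon> n"
proof -
  have "\<exists>h. \<forall>n. h n \<in> H \<and>
      (\<forall>j<n. \<forall>e\<in>S. \<bar>u (h j) e\<bar> < \<epsilon> n \<or> \<bar>u (h n) e\<bar> < \<epsilon> n)"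
  proof (rule dependent_wellorder_choice)
    fix n :: nat and h :: "nat \<Rightarrow> 'h"
    assume IH: "\<And>j. j < n \<Longrightarrow> h j \<in> H \<and>
      (\<forall>i<j. \<forall>e\<in>S. \<bar>u (h i) e\<bar> < \<epsilon> j \<or> \<bar>u (h j) e\<bar> < \<epsilon> j)"
    define F where "F = (\<Union>j<n. {e \<in> S. \<epsilon> n \<le> \<bar>u (h j) e\<bar>})"
    have "finite F"
      unfolding F_def using c0 IH \<epsilon> by (auto simp: c0_on_def)
    moreover have "F \<subseteq> S" by (auto simp: F_def)
    ultimately obtain g where g: "g \<in> H" "\<forall>e\<in>F. \<bar>u g e\<bar> < \<epsilon> n"
      using escape \<epsilon> by blast
    have "\<bar>u (h j) e\<bar> < \<epsilon> n \<or> \<bar>u g e\<bar> < \<epsilon> n" if "j < n" "e \<in> S" for j e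
      using g(2) that by (force simp: F_def)
    with g(1) show "\<exists>g. g \<in> H \<and> (\<forall>j<n. \<forall>e\<in>S. \<bar>u (h j) e\<bar> < \<epsilon> n \<or> \<bar>u g e\<bar> < \<epsilon> n)"
      by blast
  qed auto
  with that show thesis by metis
qed

text \<open>
  Of any two terms the smaller one is below the bound of the later index and hence, as \<open>\<epsilon>\<close>
  decreases, below its own bound. So only the largest term can exceed its bound, and that term is
  at most \<open>M\<close>.
\<close>

lemma sum_of_almost_disjoint:
  fixes a \<epsilon> :: "nat \<Rightarrow> real"
  assumes disj: "\<And>j n. j < n \<Longrightarrow> \<bar>a j\<bar> < \<epsilon> n \<or> \<bar>a n\<bar> < \<epsilon> n"
    and \<epsilon>: "decseq \<epsilon>" "\<And>n. 0 < \<epsilon> n"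
    and M: "\<And>n. \<bar>a n\<bar> \<le> M" and "finite J"
  shows "(\<Sum>j\<in>J. \<bar>a j\<bar>) \<le> M + (\<Sum>j\<in>J. \<epsilon> j)"
proof (cases "J = {}")
  case True
  then show ?thesis using M[of 0] by simp
next
  case False
  obtain m where m: "m \<in> J" "\<And>j. j \<in> J \<Longrightarrow> \<bar>a j\<bar> \<le> \<bar>a m\<bar>"
    using arg_min_if_finite[OF \<open>finite J\<close> False, of "\<lambda>j. - \<bar>a j\<bar>"] by (meson linorder_not_le neg_less_iff_less)
  have small: "\<bar>a j\<bar> \<le> \<epsilon> j" if "j \<in> J - {m}" for j
  proof (cases "j < m")
    case True
    then have "\<bar>a j\<bar> < \<epsilon> m" using disj[OF True] m(2)[of j] that by auto
    moreover have "\<epsilon> m \<le> \<epsilon> j" using \<epsilon>(1) True by (simp add: decseq_def)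
    ultimately show ?thesis by linarith
  next
    case False
    then have "m < j" using that by auto
    then show ?thesis using disj[of m j] m(2)[of j] that by auto
  qed
  have "(\<Sum>j\<in>J. \<bar>a j\<bar>) = \<bar>a m\<bar> + (\<Sum>j\<in>J - {m}. \<bar>a j\<bar>)"
    using m(1) \<open>finite J\<close> by (simp add: sum.remove)
  also have "\<dots> \<le> M + (\<Sum>j\<in>J - {m}. \<epsilon> j)"
    by (intro add_mono M sum_mono small)
  also have "\<dots> \<le> M + (\<Sum>j\<in>J. \<epsilon> j)"
    using \<epsilon>(2) \<open>finite J\<close> by (intro add_left_mono sum_mono2) (auto intro: less_imp_le)
  finally show ?thesis .
qed

text \<open>At a point where the term \<open>m\<close> is large, all others must be the small ones.\<close>

lemma sum_of_almost_disjoint_off_peak: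
  fixes a \<epsilon> :: "nat \<Rightarrow> real"
  assumes disj: "\<And>j n. j < n \<Longrightarrow> \<bar>a j\<bar> < \<epsilon> n \<or> \<bar>a n\<bar> < \<epsilon> n"
    and \<epsilon>: "decseq \<epsilon>"
    and peak: "\<And>n. \<epsilon> n \<le> \<bar>a m\<bar>" and "m \<notin> J"
  shows "(\<Sum>j\<in>J. \<bar>a j\<bar>) \<le> (\<Sum>j\<in>J. \<epsilon> j)"
proof (rule sum_mono)
  fix j assume "j \<in> J"
  with \<open>m \<notin> J\<close> consider "j < m" | "m < j" by (metis linorder_neqE_nat)
  then show "\<bar>a j\<bar> \<le> \<epsilon> j"
  proof cases
    case 1
    then have "\<bar>a j\<bar> < \<epsilon> m" using disj[OF 1] peak[of m] by auto
    moreover have "\<epsilon> m \<le> \<epsilon> j" using \<epsilon>(1) 1 by (simp add: decseq_def)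
    ultimately show ?thesis by linarith
  next
    case 2
    then show ?thesis using disj[OF 2] peak[of j] by auto
  qed
qed


section \<open>Displacing finite sets by co-compact groups\<close>

lemma finite_relpow_ball:
  assumes "locally_finite_graph E"
  shows "finite {y. (x, y) \<in> E ^^ n}"
proof (induction n)
  case 0
  then show ?case by simp
next
  case (Suc n)
  have "{y. (x, y) \<in> E ^^ Suc n} \<subseteq> (\<Union>z\<in>{z. (x, z) \<in> E ^^ n}. E `` {z})" by auto
  moreover have "finite (\<Union>z\<in>{z. (x, z) \<in> E ^^ n}. E `` {z})"
    using Suc assms by (simp add: locally_finite_graph_def)
  ultimately show ?case by (rule finite_subset)
qed

lemma sym_relpow:
  assumes "sym E"
  shows "(x, y) \<in> E ^^ n \<longleftrightarrow> (y, x) \<in> E ^^ n"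
proof -
  have "(x, y) \<in> E ^^ n \<Longrightarrow> (y, x) \<in> E ^^ n" for x y
  proof (induction n arbitrary: y)
    case (Suc n)
    then obtain z where "(x, z) \<in> E ^^ n" "(z, y) \<in> E" by auto
    then show ?case using Suc.IH[of z] assms by (meson relpow_Suc_I2 symD)
  qed simp
  then show ?thesis by blast
qed

lemma graph_aut_relpow:
  assumes "g \<in> graph_aut E" "(x, y) \<in> E ^^ n"
  shows "(g x, g y) \<in> E ^^ n"
  using assms(2)
proof (induction n arbitrary: y)
  case (Suc n)
  then show ?case using assms(1) by (auto simp: graph_aut_def)
qed simp

text \<open>
  The automorphisms \<open>g\<close> for which \<open>g\<inverse> v0\<close> lies in the \<open>H\<close>-orbit of \<open>v\<close> form an open set that is
  a union of left cosets of \<open>H\<close>. Compactness of the coset space leaves finitely many \<open>v\<close>, and by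
  transitivity the corresponding orbits exhaust the vertices.
\<close>

lemma cocompact_finitely_many_orbits:
  fixes E :: "('v \<times> 'v) set"
  assumes vt: "vertex_transitive E" and H: "subgroup H (aut_group E)" and cc: "cocompact E H"
  obtains F where "finite F" "\<And>x. \<exists>v\<in>F. \<exists>h\<in>H. h v = x"
proof -
  define q where "q = (\<lambda>g. g <#\<^bsub>aut_group E\<^esub> H)"
  define T where "T = aut_topology E"
  \<comment> \<open>an arbitrary base vertex\<close>
  define v0 :: 'v where "v0 = undefined"
  define Ob where "Ob = (\<lambda>v. {g \<in> graph_aut E. \<exists>h\<in>H. g (h v) = v0})"
  have top: "topspace T = graph_aut E"
    by (simp add: T_def aut_topology_def)
  have q_eq: "q g = (\<lambda>h. g \<circ> h) ` H" for g
    by (auto simp: q_def l_coset_def aut_group_def)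
  have id: "id \<in> H" and comp: "h \<in> H \<Longrightarrow> k \<in> H \<Longrightarrow> h \<circ> k \<in> H" for h k
    using subgroup.one_closed[OF H] subgroup.m_closed[OF H] by (auto simp: aut_group_def)
  have qm: "quotient_map T (quotient_topology T q) q" by (rule quotient_map_quotient_topology)
  have openO: "openin T (Ob v)" for v
  proof -
    have "openin T {g \<in> topspace T. g w \<in> {v0}}" for w
    proof (rule openin_continuous_map_preimage)
      show "continuous_map T (discrete_topology UNIV) (\<lambda>g. g w)"
        unfolding T_def aut_topology_def
        by (intro continuous_map_from_subtopology continuous_map_product_projection) simp
    qed simp
    then have "openin T (\<Union>h\<in>H. {g \<in> topspace T. g (h v) \<in> {v0}})" by blast
    also have "(\<Union>h\<in>H. {g \<in> topspace T. g (h v) \<in> {v0}}) = Ob v"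
      by (auto simp: Ob_def top)
    finally show ?thesis .
  qed
  have sat: "{g \<in> topspace T. q g \<in> q ` Ob v} = Ob v" for v
  proof
    show "{g \<in> topspace T. q g \<in> q ` Ob v} \<subseteq> Ob v"
    proof clarify
      fix g g' assume g: "g \<in> topspace T" "q g = q g'" "g' \<in> Ob v"
      have "g' \<circ> id \<in> q g'" unfolding q_eq using id by blast
      with g(2) have "g' \<in> q g" by simp
      then obtain h where h: "h \<in> H" "g' = g \<circ> h" unfolding q_eq by blast
      obtain k where k: "k \<in> H" "g' (k v) = v0" using g(3) by (auto simp: Ob_def)
      have "g ((h \<circ> k) v) = v0" using k(2) h(2) by simp
      with comp[OF h(1) k(1)] g(1) show "g \<in> Ob v" unfolding Ob_def top by blast
    qed
  qed (auto simp: Ob_def top)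
  have open_qO: "openin (quotient_topology T q) (q ` Ob v)" for v
    unfolding openin_quotient_topology sat using openO by (auto simp: Ob_def top)
  have cover: "topspace (quotient_topology T q) \<subseteq> \<Union>(range (\<lambda>v. q ` Ob v))"
  proof
    fix c assume "c \<in> topspace (quotient_topology T q)"
    then have "c \<in> q ` graph_aut E"
      using quotient_imp_surjective_map[OF qm] top by simp
    then obtain g where g: "g \<in> graph_aut E" "c = q g" by blast
    then have "surj g" by (simp add: graph_aut_def bij_is_surj)
    then obtain v where "g v = v0" by (metis surjD)
    then have "g \<in> Ob v" using g id by (auto simp: Ob_def intro!: bexI[of _ id])
    with g(2) show "c \<in> \<Union>(range (\<lambda>v. q ` Ob v))" by blast
  qed
  have "compactin (quotient_topology T q) (topspace (quotient_topology T q))"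
    using cc by (simp add: cocompact_def compact_space_def T_def q_def)
  then have "\<exists>\<F>. finite \<F> \<and> \<F> \<subseteq> range (\<lambda>v. q ` Ob v) \<and>
      topspace (quotient_topology T q) \<subseteq> \<Union>\<F>"
    by (rule compactinD[OF _ _ cover]) (use open_qO in blast)
  then obtain \<F> where "finite \<F>" "\<F> \<subseteq> range (\<lambda>v. q ` Ob v)"
    "topspace (quotient_topology T q) \<subseteq> \<Union>\<F>"
    by blast
  then obtain F where F: "finite F" "topspace (quotient_topology T q) \<subseteq> (\<Union>v\<in>F. q ` Ob v)"
    by (metis finite_subset_image)
  have "\<exists>v\<in>F. \<exists>h\<in>H. h v = x" for x
  proof -
    obtain g where g: "g \<in> graph_aut E" "g x = v0" using vt by (auto simp: vertex_transitive_def)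
    then have "q g \<in> topspace (quotient_topology T q)"
      using quotient_imp_surjective_map[OF qm] top by blast
    then obtain v where v: "v \<in> F" "q g \<in> q ` Ob v" using F(2) by blast
    then have "g \<in> Ob v" using sat g(1) top by blast
    then obtain h where "h \<in> H" "g (h v) = v0" by (auto simp: Ob_def)
    moreover have "inj g" using g(1) by (auto simp: graph_aut_def bij_is_inj)
    ultimately show ?thesis using g(2) v(1) by (metis injD)
  qed
  with F(1) that show thesis by blast
qed

text \<open>
  Some orbit of \<open>H\<close> is infinite. As \<open>H\<close> acts by isometries and balls are finite, an element that
  moves one point of this orbit far away moves any prescribed finite set far away.
\<close>

lemma cocompact_displaces_finite_sets:
  fixes E :: "('v \<times> 'v) set"
  assumes sym: "sym E" and conn: "connected_graph E" and lf: "locally_finite_graph E"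
    and vt: "vertex_transitive E" and inf: "infinite (UNIV :: 'v set)"
    and H: "subgroup H (aut_group E)" and cc: "cocompact E H"
    and A: "finite A" and B: "finite B"
  obtains h where "h \<in> H" "h ` A \<inter> B = {}"
proof -
  have aut: "h \<in> graph_aut E" if "h \<in> H" for h
    using subgroup.subset[OF H] that by (auto simp: aut_group_def)
  obtain F where F: "finite F" "\<And>x. \<exists>v\<in>F. \<exists>h\<in>H. h v = x"
    using cocompact_finitely_many_orbits[OF vt H cc] by blast
  have "x \<in> (\<Union>v\<in>F. (\<lambda>h. h v) ` H)" for x
    using F(2)[of x] by auto
  then have "(\<Union>v\<in>F. (\<lambda>h. h v) ` H) = UNIV" by blast
  then obtain w where w: "infinite ((\<lambda>h. h w) ` H)"
    using inf F(1) by (metis finite_UN_I)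
  have "\<exists>n. (w, a) \<in> E ^^ n" for a
    using conn by (simp add: connected_graph_def rtrancl_power)
  then obtain r where r: "\<And>a. (w, a) \<in> E ^^ r a" by metis
  \<comment> \<open>\<open>h w\<close> lies here whenever \<open>h\<close> maps a point of \<open>A\<close> into \<open>B\<close>\<close>
  define Bad where "Bad = (\<Union>a\<in>A. \<Union>b\<in>B. {y. (b, y) \<in> E ^^ r a})"
  have "finite Bad" unfolding Bad_def using A B finite_relpow_ball[OF lf] by blast
  with w obtain h where h: "h \<in> H" "h w \<notin> Bad"
    by (metis (no_types, lifting) finite_subset image_subsetI)
  have "h a \<notin> B" if "a \<in> A" for a
  proof
    assume "h a \<in> B"
    moreover have "(h a, h w) \<in> E ^^ r a"
      using graph_aut_relpow[OF aut[OF h(1)] r] sym_relpow[OF sym] by metis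
    ultimately show False using h(2) that by (auto simp: Bad_def)
  qed
  then show thesis using that[OF h(1)] by auto
qed


section \<open>Lipschitz functions and their gradients\<close>

text \<open>A path of length \<open>n\<close> changes the function by at most \<open>n * L\<close>.\<close>

lemma lip_bound_of_edges:
  assumes conn: "connected_graph E" and "0 \<le> L"
    and edge: "\<And>x y. (x, y) \<in> E \<Longrightarrow> \<bar>f y - f x\<bar> \<le> L"
  shows "lip_bound E f L"
proof -
  have "\<bar>f x - f y\<bar> \<le> L * real n" if "(x, y) \<in> E ^^ n" for x y n
    using that
  proof (induction n arbitrary: y)
    case (Suc n)
    then obtain z where z: "(x, z) \<in> E ^^ n" "(z, y) \<in> E" by auto
    have "\<bar>f x - f y\<bar> \<le> \<bar>f x - f z\<bar> + \<bar>f y - f z\<bar>" by linarith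
    also have "\<dots> \<le> L * real n + L" using Suc.IH[OF z(1)] edge[OF z(2)] by linarith
    finally show ?case by (simp add: algebra_simps)
  qed simp
  moreover have "(x, y) \<in> E ^^ gdist E x y" for x y
    using conn unfolding gdist_def connected_graph_def rtrancl_power
    by (metis LeastI_ex)
  ultimately show ?thesis using \<open>0 \<le> L\<close> by (simp add: lip_bound_def)
qed

lemma lip_bound_edge:
  assumes "lip_bound E f L" "(x, y) \<in> E"
  shows "\<bar>f y - f x\<bar> \<le> L"
proof -
  have "gdist E x y \<le> 1"
    unfolding gdist_def by (rule Least_le) (use assms(2) in simp)
  then have "L * real (gdist E x y) \<le> L * 1"
    using assms(1) by (intro mult_left_mono) (auto simp: lip_bound_def)
  moreover have "\<bar>f x - f y\<bar> \<le> L * real (gdist E x y)" using assms(1) by (simp add: lip_bound_def)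
  ultimately show ?thesis by linarith
qed

lemma Lip0_memI: "f v0 = 0 \<Longrightarrow> lip_bound E f L \<Longrightarrow> f \<in> vecs (Lip0 E v0)"
  by (auto simp: Lip0_def)

lemma Lip0_norm_le: "lip_bound E f L \<Longrightarrow> vnorm (Lip0 E v0) f \<le> L"
  by (auto simp: Lip0_def lip_bound_def intro!: cInf_lower bdd_belowI[of _ 0])

text \<open>The Lipschitz bounds of a function form a closed set, so the optimal one is a bound.\<close>

lemma Lip0_norm_attained:
  assumes "f \<in> vecs (Lip0 E v0)"
  shows "lip_bound E f (vnorm (Lip0 E v0) f)"
proof -
  define S where "S = {L. lip_bound E f L}"
  have S: "S \<noteq> {}" "bdd_below S"
    using assms by (auto simp: S_def Lip0_def lip_bound_def intro!: bdd_belowI[of _ 0])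
  have "closed S"
    unfolding S_def lip_bound_def
    by (intro closed_Collect_conj closed_Collect_all closed_Collect_le continuous_intros)
  from closed_contains_Inf[OF S this] show ?thesis
    by (simp add: S_def Lip0_def)
qed

lemma Lip0_ops [simp]:
  "vzero (Lip0 E v0) = (\<lambda>_. 0)"
  "vadd (Lip0 E v0) = (\<lambda>f g x. f x + g x)"
  "vscale (Lip0 E v0) = (\<lambda>c f x. c * f x)"
  by (simp_all add: Lip0_def)

lemma lip_bound_add: "lip_bound E f L \<Longrightarrow> lip_bound E g M \<Longrightarrow> lip_bound E (\<lambda>x. f x + g x) (L + M)"
  unfolding lip_bound_def
proof (intro conjI allI)
  fix x y
  assume *: "0 \<le> L \<and> (\<forall>x y. \<bar>f x - f y\<bar> \<le> L * real (gdist E x y))"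
    "0 \<le> M \<and> (\<forall>x y. \<bar>g x - g y\<bar> \<le> M * real (gdist E x y))"
  then have "\<bar>f x - f y\<bar> \<le> L * real (gdist E x y)" "\<bar>g x - g y\<bar> \<le> M * real (gdist E x y)" by auto
  then show "\<bar>f x + g x - (f y + g y)\<bar> \<le> (L + M) * real (gdist E x y)"
    unfolding distrib_right by linarith
qed auto

lemma lip_bound_scale: "lip_bound E f L \<Longrightarrow> lip_bound E (\<lambda>x. c * f x) (\<bar>c\<bar> * L)"
  unfolding lip_bound_def
  by (auto simp: abs_mult mult.assoc mult_left_mono simp flip: right_diff_distrib)

lemma Lip0_closed:
  assumes "f \<in> vecs (Lip0 E v0)"
  shows "g \<in> vecs (Lip0 E v0) \<Longrightarrow> (\<lambda>x. f x + g x) \<in> vecs (Lip0 E v0)"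
    and "(\<lambda>x. c * f x) \<in> vecs (Lip0 E v0)"
  using assms lip_bound_add[of E f] lip_bound_scale[of E f] unfolding Lip0_def by auto blast+

lemma pointwise_closed_limit:
  assumes X: "pointwise_closed E v0 X" and F: "\<And>n. F n \<in> X"
    and lim: "\<And>v. (\<lambda>n. F n v) \<longlonglongrightarrow> g v" and g: "g \<in> vecs (Lip0 E v0)"
  shows "g \<in> X"
proof -
  obtain C where C: "closed C" "X = vecs (Lip0 E v0) \<inter> C"
    using X unfolding pointwise_closed_def closedin_closed by blast
  have "limitin (product_topology (\<lambda>_. euclidean) UNIV) F g sequentially"
    unfolding limitin_componentwise using lim by (auto simp: limitin_canonical_iff)
  then have "(F \<longlongrightarrow> g) sequentially"
    by (simp add: euclidean_product_topology limitin_canonical_iff)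
  then have "g \<in> C"
    using Lim_in_closed_set[OF C(1)] F C(2) by (metis IntD2 always_eventually sequentially_bot)
  with g C(2) show ?thesis by blast
qed

text \<open>
  The common core of all conclusions: a bounded linear map \<open>W\<close> from \<open>\<ell>\<^sub>\<infinity>\<close> into \<open>X\<close> that is a
  right inverse to reading off the gradient along a fixed sequence of edges \<open>(x n, y n)\<close>.
\<close>

locale gradient_interpolation =
  fixes E :: "('v \<times> 'v) set" and v0 :: 'v and X :: "('v \<Rightarrow> real) set"
    and x y :: "nat \<Rightarrow> 'v" and W :: "(nat \<Rightarrow> real) \<Rightarrow> 'v \<Rightarrow> real" and C :: real
  assumes subspace: "linear_subspace (Lip0 E v0) X"
    and edge: "\<And>n. (x n, y n) \<in> E"
    and W_mem: "\<And>b. bounded (range b) \<Longrightarrow> W b \<in> X"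
    and W_bound: "\<And>b B. (\<And>n. \<bar>b n\<bar> \<le> B) \<Longrightarrow> lip_bound E (W b) (C * B)"
    and W_add: "\<And>b c. bounded (range b) \<Longrightarrow> bounded (range c) \<Longrightarrow>
      W (\<lambda>n. b n + c n) = (\<lambda>v. W b v + W c v)"
    and W_scale: "\<And>b r. bounded (range b) \<Longrightarrow> W (\<lambda>n. r * b n) = (\<lambda>v. r * W b v)"
    and W_interp: "\<And>b n. bounded (range b) \<Longrightarrow> W b (y n) - W b (x n) = b n"

lemma bounded_range_iff_abs: "bounded (range b) \<longleftrightarrow> (\<exists>B. \<forall>n. \<bar>b n\<bar> \<le> B)" for b :: "nat \<Rightarrow> real"
  by (auto simp: bounded_iff)

lemma bounded_range_add:
  "bounded (range b) \<Longrightarrow> bounded (range c) \<Longrightarrow> bounded (range (\<lambda>n. b n + c n))"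
  for b c :: "nat \<Rightarrow> real"
  by (rule bounded_plus_comp)

lemma bounded_range_scale: "bounded (range b) \<Longrightarrow> bounded (range (\<lambda>n. r * b n))"
  for b :: "nat \<Rightarrow> real"
  using bounded_scaleR_comp[of b UNIV r] by simp

text \<open>
  Functions \<open>f j\<close> in \<open>X\<close> whose gradients are uniformly absolutely summable can be combined with
  arbitrary bounded coefficients, the sum being taken pointwise. If moreover the matrix of their
  gradients along the edges is close to the identity, correcting the coefficients by its inverse
  gives exact interpolation.
\<close>

lemma interpolation_from_almost_biorthogonal:
  fixes E :: "('v \<times> 'v) set" and f :: "nat \<Rightarrow> 'v \<Rightarrow> real" and x y :: "nat \<Rightarrow> 'v"
  assumes conn: "connected_graph E"
    and sub: "linear_subspace (Lip0 E v0) X" and closed: "pointwise_closed E v0 X"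
    and f: "\<And>j. f j \<in> X" and edge: "\<And>n. (x n, y n) \<in> E"
    and grad: "\<And>v w N. (v, w) \<in> E \<Longrightarrow> (\<Sum>j<N. \<bar>f j w - f j v\<bar>) \<le> M"
    and diag: "\<And>n. f n (y n) - f n (x n) = 1"
    and offdiag: "\<And>n N. (\<Sum>j\<in>{..<N} - {n}. \<bar>f j (y n) - f j (x n)\<bar>) \<le> 1/2"
  shows "\<exists>W. gradient_interpolation E v0 X x y W (2 * M)"
proof -
  have f0: "f j v0 = 0" for j
    using f[of j] sub by (auto simp: linear_subspace_def Lip0_def)
  have M: "0 \<le> M" using grad[OF edge, of 0 0] by simp
  have summ0: "\<exists>D. \<forall>N. (\<Sum>j<N. \<bar>f j v\<bar>) \<le> D" for v
  proof -
    have "(v0, v) \<in> E\<^sup>*" using conn by (simp add: connected_graph_def)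
    then show ?thesis
    proof induction
      case base
      then show ?case by (auto simp: f0)
    next
      case (step v w)
      then obtain D where D: "\<And>N. (\<Sum>j<N. \<bar>f j v\<bar>) \<le> D" by blast
      have "(\<Sum>j<N. \<bar>f j w\<bar>) \<le> D + M" for N
      proof -
        have "(\<Sum>j<N. \<bar>f j w\<bar>) \<le> (\<Sum>j<N. \<bar>f j v\<bar> + \<bar>f j w - f j v\<bar>)"
          by (intro sum_mono) linarith
        then show ?thesis using D[of N] grad[OF step(2), of N] by (simp add: sum.distrib)
      qed
      then show ?case by blast
    qed
  qed
  then have "\<exists>D. \<forall>v N. (\<Sum>j<N. \<bar>f j v\<bar>) \<le> D v" by metis
  then obtain D where D: "\<And>v N. (\<Sum>j<N. \<bar>f j v\<bar>) \<le> D v" by blast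
  have sm: "summable (\<lambda>j. b j * f j v)" if "bounded (range b)" for b v
    using that bounded_combination_of_abs_summable(2)[OF D[of v], of b]
    by (auto simp: bounded_range_iff_abs)
  define V where "V = (\<lambda>b v. \<Sum>j. b j * f j v)"
  have V_grad: "V b w - V b v = (\<Sum>j. b j * (f j w - f j v))" if "bounded (range b)" for b v w
    unfolding V_def by (subst suminf_diff[OF sm sm]) (simp_all add: that right_diff_distrib)
  have V_lip: "lip_bound E (V b) (B * M)" if B: "\<And>n. \<bar>b n\<bar> \<le> B" for b B
  proof (rule lip_bound_of_edges[OF conn])
    show "0 \<le> B * M" using B[of 0] M by auto
    fix v w assume vw: "(v, w) \<in> E"
    have "bounded (range b)" using B by (auto simp: bounded_range_iff_abs)
    then show "\<bar>V b w - V b v\<bar> \<le> B * M"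
      using bounded_combination_of_abs_summable(3)[OF grad[OF vw] B] by (simp add: V_grad)
  qed
  have V_mem: "V b \<in> X" if b: "bounded (range b)" for b
  proof (rule pointwise_closed_limit[OF closed])
    have "(\<lambda>v. \<Sum>j<n. b j * f j v) \<in> X" for n
    proof (induction n)
      case 0
      then show ?case using sub by (simp add: linear_subspace_def)
    next
      case (Suc n)
      have "(\<lambda>v. b n * f n v) \<in> X" using sub f[of n] by (simp add: linear_subspace_def)
      with Suc show ?case using sub by (simp add: linear_subspace_def)
    qed
    then show "(\<lambda>v. \<Sum>j<n. b j * f j v) \<in> X" for n .
    show "(\<lambda>n. \<Sum>j<n. b j * f j v) \<longlonglongrightarrow> V b v" for v
      unfolding V_def by (rule summable_LIMSEQ[OF sm[OF b]])
    obtain B where "\<And>n. \<bar>b n\<bar> \<le> B" using b by (auto simp: bounded_range_iff_abs)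
    from V_lip[OF this] show "V b \<in> vecs (Lip0 E v0)"
      by (intro Lip0_memI) (simp_all add: V_def f0)
  qed
  have V_add: "V (\<lambda>n. b n + c n) = (\<lambda>v. V b v + V c v)"
    if "bounded (range b)" "bounded (range c)" for b c
    unfolding V_def using that by (auto simp: distrib_right suminf_add sm)
  have V_scale: "V (\<lambda>n. r * b n) = (\<lambda>v. r * V b v)" if "bounded (range b)" for b r
    unfolding V_def using that by (auto simp: mult.assoc suminf_mult sm)
  \<comment> \<open>the off-diagonal part of the reading matrix\<close>
  define K where "K = (\<lambda>n j. if j = n then 0 else f j (y n) - f j (x n))"
  have K: "(\<Sum>j<N. \<bar>K n j\<bar>) \<le> 1/2" for n N
  proof -
    have "(\<Sum>j<N. \<bar>K n j\<bar>) = (\<Sum>j\<in>{..<N} - {n}. \<bar>f j (y n) - f j (x n)\<bar>)"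
      unfolding K_def by (intro sum.mono_neutral_cong_right) auto
    then show ?thesis using offdiag by simp
  qed
  have V_read: "V b (y n) - V b (x n) = b n + (\<Sum>j. b j * K n j)" if b: "bounded (range b)" for b n
  proof -
    obtain B where "\<And>n. \<bar>b n\<bar> \<le> B" using b by (auto simp: bounded_range_iff_abs)
    then have sK: "summable (\<lambda>j. b j * K n j)"
      by (rule bounded_combination_of_abs_summable(2)[OF K])
    have "b j * (f j (y n) - f j (x n)) = (if j = n then b j else 0) + b j * K n j" for j
      using diag by (simp add: K_def)
    then have "V b (y n) - V b (x n) = (\<Sum>j. (if j = n then b j else 0) + b j * K n j)"
      by (simp add: V_grad[OF b])
    also have "\<dots> = (\<Sum>j. if j = n then b j else 0) + (\<Sum>j. b j * K n j)"
      by (rule suminf_add[symmetric, OF sums_summable[OF sums_single] sK])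
    also have "(\<Sum>j. if j = n then b j else 0) = b n"
      by (rule sums_unique[OF sums_single, symmetric])
    finally show ?thesis .
  qed
  \<comment> \<open>the inverse of the reading matrix; \<open>V \<circ> R\<close> will be the interpolation map\<close>
  define R where "R = (\<lambda>c. SOME b. bounded (range b) \<and> (\<forall>n. b n + (\<Sum>j. b j * K n j) = c n))"
  have R: "bounded (range (R c)) \<and> (\<forall>n. R c n + (\<Sum>j. R c j * K n j) = c n)"
    if "bounded (range c)" for c
  proof -
    obtain B where "\<And>n. \<bar>c n\<bar> \<le> B" using \<open>bounded (range c)\<close> by (auto simp: bounded_range_iff_abs)
    from perturbed_identity_surjective[of K c, OF K this] show ?thesis
      unfolding R_def by (intro someI_ex[of "\<lambda>b. bounded (range b) \<and> (\<forall>n. b n + (\<Sum>j. b j * K n j) = c n)"]) blast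
  qed
  have R_V: "V (R c) (y n) - V (R c) (x n) = c n" if "bounded (range c)" for c n
    using R[OF that] by (simp add: V_read)
  \<comment> \<open>uniqueness of the coefficients makes \<open>R\<close> linear\<close>
  have uniq: "b = R c" if b: "bounded (range b)" and c: "bounded (range c)"
    and eq: "\<And>n. V b (y n) - V b (x n) = c n" for b c
  proof
    fix n
    let ?d = "\<lambda>n. b n + (-1) * R c n"
    have d: "bounded (range ?d)"
      using b R[OF c] by (intro bounded_range_add bounded_range_scale) auto
    have "V ?d = (\<lambda>v. V b v + (-1) * V (R c) v)"
      using b R[OF c] V_scale[of "R c" "-1"] V_add[of b "\<lambda>n. -1 * R c n"]
        bounded_range_scale[of "R c" "-1"] by auto
    then have "?d n + (\<Sum>j. ?d j * K n j) = 0" for n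
      using V_read[OF d, of n] eq[of n] R_V[OF c, of n] by simp
    from perturbed_identity_bounded_below[of K ?d "\<lambda>_. 0" 0 n, OF K d _ this]
    show "b n = R c n" by simp
  qed
  have "gradient_interpolation E v0 X x y (\<lambda>c. V (R c)) (2 * M)"
  proof
    fix b c :: "nat \<Rightarrow> real" and B r :: real
    assume b: "bounded (range b)"
    note Rb = R[OF b, THEN conjunct1]
    show "V (R b) \<in> X" using V_mem[OF Rb] .
    show "V (R b) (y n) - V (R b) (x n) = b n" for n by (rule R_V[OF b])
    have "(\<lambda>n. r * R b n) = R (\<lambda>n. r * b n)"
      using R_V[OF b]
      by (intro uniq bounded_range_scale Rb b) (simp add: V_scale[OF Rb] flip: right_diff_distrib)
    then show "V (R (\<lambda>n. r * b n)) = (\<lambda>v. r * V (R b) v)"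
      using V_scale[OF Rb, of r] by simp
    assume c: "bounded (range c)"
    note Rc = R[OF c, THEN conjunct1]
    have "(\<lambda>n. R b n + R c n) = R (\<lambda>n. b n + c n)"
    proof (intro uniq bounded_range_add Rb Rc b c)
      show "V (\<lambda>n. R b n + R c n) (y n) - V (\<lambda>n. R b n + R c n) (x n) = b n + c n" for n
        using R_V[OF b, of n] R_V[OF c, of n] by (simp add: V_add[OF Rb Rc])
    qed
    then show "V (R (\<lambda>n. b n + c n)) = (\<lambda>v. V (R b) v + V (R c) v)"
      using V_add[OF Rb Rc] by simp
  next
    fix b :: "nat \<Rightarrow> real" and B assume B: "\<And>n. \<bar>b n\<bar> \<le> B"
    then have b: "bounded (range b)" by (auto simp: bounded_range_iff_abs)
    have "\<bar>R b n\<bar> \<le> 2 * B" for n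
      using perturbed_identity_bounded_below[of K "R b" b B n] K B R[OF b] by blast
    from V_lip[OF this] show "lip_bound E (V (R b)) (2 * M * B)" by (simp add: mult_ac)
  qed (use sub edge in auto)
  then show ?thesis by blast
qed


section \<open>Translates of a function with vanishing gradient\<close>

lemma gradient_aut_act:
  assumes "h \<in> graph_aut E"
  shows "gradient (aut_act v0 h f) (h v, h w) = gradient f (v, w)"
  using assms by (simp add: graph_aut_def gradient_def aut_act_def bij_is_inj)

lemma graph_aut_edge_preimage:
  assumes "h \<in> graph_aut E" "e \<in> E"
  obtains e' where "e' \<in> E" "e = map_prod h h e'"
proof -
  have "surj h" using assms(1) by (simp add: graph_aut_def bij_is_surj)
  then obtain v w where "fst e = h v" "snd e = h w" by (metis surjD)
  then have "e = map_prod h h (v, w)" by (simp add: prod_eq_iff)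
  moreover have "(v, w) \<in> E" using assms calculation by (simp add: graph_aut_def)
  ultimately show thesis using that by blast
qed

lemma c0_gradient_aut_act:
  assumes h: "h \<in> graph_aut E" and c0: "c0_on E (gradient f)"
  shows "c0_on E (gradient (aut_act v0 h f))"
  unfolding c0_on_def
proof (intro allI impI)
  fix \<epsilon> :: real assume "0 < \<epsilon>"
  then have "finite (map_prod h h ` {e \<in> E. \<epsilon> \<le> \<bar>gradient f e\<bar>})"
    using c0 by (simp add: c0_on_def)
  moreover have "{e \<in> E. \<epsilon> \<le> \<bar>gradient (aut_act v0 h f) e\<bar>}
      \<subseteq> map_prod h h ` {e \<in> E. \<epsilon> \<le> \<bar>gradient f e\<bar>}"
  proof clarify
    fix v w assume e: "(v, w) \<in> E" "\<epsilon> \<le> \<bar>gradient (aut_act v0 h f) (v, w)\<bar>"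
    obtain e' where "e' \<in> E" "(v, w) = map_prod h h e'"
      using graph_aut_edge_preimage[OF h e(1)] by blast
    with e(2) show "(v, w) \<in> map_prod h h ` {e \<in> E. \<epsilon> \<le> \<bar>gradient f e\<bar>}"
      by (cases e') (auto simp: gradient_aut_act[OF h])
  qed
  ultimately show "finite {e \<in> E. \<epsilon> \<le> \<bar>gradient (aut_act v0 h f) e\<bar>}"
    by (rule finite_subset[rotated])
qed

text \<open>
  Displacing the finitely many edges with large gradient from \<open>F\<close> leaves small values on \<open>F\<close>; it
  suffices to displace the initial vertices.
\<close>

lemma translate_gradient_escapes:
  fixes E :: "('v \<times> 'v) set"
  assumes "sym E" "connected_graph E" "locally_finite_graph E" "vertex_transitive E"
    "infinite (UNIV :: 'v set)" and H: "subgroup H (aut_group E)" and "cocompact E H"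
    and c0: "c0_on E (gradient f)" and F: "finite F" "F \<subseteq> E" and "0 < \<delta>"
  shows "\<exists>h\<in>H. \<forall>e\<in>F. \<bar>gradient (aut_act v0 h f) e\<bar> < \<delta>"
proof -
  define S where "S = {e \<in> E. \<delta> \<le> \<bar>gradient f e\<bar>}"
  have "finite (fst ` S)" "finite (fst ` F)"
    using c0 \<open>0 < \<delta>\<close> F by (auto simp: S_def c0_on_def)
  then obtain h where h: "h \<in> H" "h ` fst ` S \<inter> fst ` F = {}"
    using cocompact_displaces_finite_sets[of E H "fst ` S" "fst ` F"] assms(1-7) by metis
  have aut: "h \<in> graph_aut E" using subgroup.subset[OF H] h(1) by (auto simp: aut_group_def)
  have "\<bar>gradient (aut_act v0 h f) e\<bar> < \<delta>" if "e \<in> F" for e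
  proof -
    have "e \<in> E" using F(2) that by blast
    then obtain e' where e': "e' \<in> E" "e = map_prod h h e'"
      using graph_aut_edge_preimage[OF aut] by metis
    have "e' \<notin> S"
    proof
      assume "e' \<in> S"
      then have "h (fst e') \<in> h ` fst ` S" by blast
      moreover have "h (fst e') \<in> fst ` F" using that e'(2) by force
      ultimately show False using h(2) by blast
    qed
    then show ?thesis using e' by (cases e') (auto simp: S_def gradient_aut_act[OF aut])
  qed
  with h(1) show ?thesis by blast
qed

text \<open>
  A nonzero function vanishing at the base point has a nonzero gradient at some edge, as otherwise
  0 would be a Lipschitz bound.
\<close>

lemma normalised_function_with_vanishing_gradient:
  assumes conn: "connected_graph E" and sub: "linear_subspace (Lip0 E v0) X"
    and ne: "X \<inter> Lip0_inf E v0 \<noteq> {\<lambda>_. 0}"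
  obtains f p q where "f \<in> X" "c0_on E (gradient f)" "(p, q) \<in> E" "f q - f p = 1"
proof -
  have "(\<lambda>_. 0) \<in> X" using sub by (simp add: linear_subspace_def)
  moreover have "(\<lambda>_. 0) \<in> Lip0_inf E v0"
    by (auto simp: Lip0_inf_def Lip0_def lip_bound_def c0_on_def gradient_def)
  ultimately obtain g where g: "g \<in> X" "g \<in> Lip0_inf E v0" "g \<noteq> (\<lambda>_. 0)"
    using ne by blast
  have "\<exists>(p, q)\<in>E. g q \<noteq> g p"
  proof (rule ccontr)
    assume "\<not> ?thesis"
    then have "lip_bound E g 0" by (intro lip_bound_of_edges[OF conn]) auto
    then have "g v = g v0" for v by (simp add: lip_bound_def)
    moreover have "g v0 = 0" using g(2) by (simp add: Lip0_inf_def Lip0_def)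
    ultimately show False using g(3) by auto
  qed
  then obtain p q where pq: "(p, q) \<in> E" "g q \<noteq> g p" by blast
  define r where "r = 1 / (g q - g p)"
  define f where "f = (\<lambda>v. r * g v)"
  have r: "r \<noteq> 0" using pq(2) by (simp add: r_def)
  have fX: "f \<in> X" using sub g(1) by (simp add: f_def linear_subspace_def)
  have gr: "gradient f e = r * gradient g e" for e
    by (cases e) (simp add: gradient_def f_def right_diff_distrib)
  have "c0_on E (gradient f)"
    unfolding c0_on_def
  proof (intro allI impI)
    fix \<epsilon> :: real assume "0 < \<epsilon>"
    then have "finite {e \<in> E. \<epsilon> / \<bar>r\<bar> \<le> \<bar>gradient g e\<bar>}"
      using g(2) r by (simp add: Lip0_inf_def c0_on_def)
    then show "finite {e \<in> E. \<epsilon> \<le> \<bar>gradient f e\<bar>}"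
      using r by (simp add: gr abs_mult field_simps)
  qed
  moreover have "f q - f p = 1"
    using pq(2) by (simp add: f_def r_def flip: diff_divide_distrib)
  ultimately show thesis using fX pq(1) that by blast
qed

text \<open>
  The gradients of suitable translates form a sliding hump. With \<open>\<epsilon> n = 2\<^sup>-\<^sup>n/4\<close> the small
  parts add up to at most \<open>1/2\<close>.
\<close>

lemma exists_gradient_interpolation:
  fixes E :: "('v \<times> 'v) set"
  assumes graph: "sym E" "connected_graph E" "locally_finite_graph E" "vertex_transitive E"
    "infinite (UNIV :: 'v set)" and H: "subgroup H (aut_group E)" and cc: "cocompact E H"
    and sub: "linear_subspace (Lip0 E v0) X" and closed: "pointwise_closed E v0 X"
    and inv: "invariant_under v0 H X" and ne: "X \<inter> Lip0_inf E v0 \<noteq> {\<lambda>_. 0}"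
  shows "\<exists>x y W C. gradient_interpolation E v0 X x y W C"
proof -
  obtain f p q where f: "f \<in> X" and c0: "c0_on E (gradient f)"
    and pq: "(p, q) \<in> E" "f q - f p = 1"
    using normalised_function_with_vanishing_gradient[OF graph(2) sub ne] by metis
  obtain M where M: "lip_bound E f M" using f sub by (auto simp: linear_subspace_def Lip0_def)
  have aut: "h \<in> graph_aut E" if "h \<in> H" for h
    using subgroup.subset[OF H] that by (auto simp: aut_group_def)
  define u where "u = (\<lambda>h. gradient (aut_act v0 h f))"
  define \<epsilon> :: "nat \<Rightarrow> real" where "\<epsilon> = (\<lambda>n. (1/2) ^ n / 4)"
  have \<epsilon>: "0 < \<epsilon> n" "\<epsilon> n \<le> 1" for n
    using power_le_one[of "1/2 :: real" n] by (auto simp: \<epsilon>_def)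
  have dec: "decseq \<epsilon>"
    by (auto simp: \<epsilon>_def decseq_def intro!: divide_right_mono power_decreasing)
  have sum_\<epsilon>: "(\<Sum>j\<in>J. \<epsilon> j) \<le> 1/2" if "finite J" for J
  proof -
    have "(\<Sum>j\<in>J. \<epsilon> j) \<le> (\<Sum>j. \<epsilon> j)"
      using that \<epsilon>(1) by (intro sum_le_suminf) (auto simp: \<epsilon>_def less_imp_le intro!: summable_divide)
    also have "\<dots> = 1/2"
      unfolding \<epsilon>_def by (subst suminf_divide) (simp_all add: suminf_geometric)
    finally show ?thesis .
  qed
  obtain h where h: "\<And>n. h n \<in> H"
    and hump: "\<And>j n e. j < n \<Longrightarrow> e \<in> E \<Longrightarrow> \<bar>u (h j) e\<bar> < \<epsilon> n \<or> \<bar>u (h n) e\<bar> < \<epsilon> n"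
  proof (rule sliding_hump[of H E u \<epsilon>])
    show "c0_on E (u g)" if "g \<in> H" for g
      unfolding u_def by (rule c0_gradient_aut_act[OF aut[OF that] c0])
    show "\<exists>g\<in>H. \<forall>e\<in>F. \<bar>u g e\<bar> < \<delta>" if "finite F" "F \<subseteq> E" "0 < \<delta>" for F \<delta>
      unfolding u_def by (rule translate_gradient_escapes[OF graph H cc c0 that])
  qed (use \<epsilon> in auto)
  define k where "k = (\<lambda>j. aut_act v0 (h j) f)"
  have k_u: "k j w - k j v = u (h j) (v, w)" for j v w
    by (simp add: k_def u_def gradient_def)
  have u_le: "\<bar>u (h j) e\<bar> \<le> M" if e: "e \<in> E" for j e
  proof -
    obtain e' where "e' \<in> E" "e = map_prod (h j) (h j) e'"
      using graph_aut_edge_preimage[OF aut[OF h] e] by metis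
    then show ?thesis
      using lip_bound_edge[OF M]
      by (cases e') (auto simp: u_def gradient_aut_act[OF aut[OF h]], simp add: gradient_def)
  qed
  have peak: "u (h n) (h n p, h n q) = 1" for n
    unfolding u_def gradient_aut_act[OF aut[OF h]] by (simp add: gradient_def pq(2))
  have edge: "(h n p, h n q) \<in> E" for n
    using aut[OF h, of n] pq(1) by (simp add: graph_aut_def)
  have "\<exists>W. gradient_interpolation E v0 X (\<lambda>n. h n p) (\<lambda>n. h n q) W (2 * (M + 1/2))"
  proof (rule interpolation_from_almost_biorthogonal[OF graph(2) sub closed, of k])
    show "k j \<in> X" for j using inv h[of j] f by (auto simp: k_def invariant_under_def)
    show "(h n p, h n q) \<in> E" for n by (rule edge)
    show "(\<Sum>j<N. \<bar>k j w - k j v\<bar>) \<le> M + 1/2" if vw: "(v, w) \<in> E" for v w N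
      using sum_of_almost_disjoint[of "\<lambda>j. u (h j) (v, w)" \<epsilon> M "{..<N}"] sum_\<epsilon>[of "{..<N}"]
        hump[OF _ vw] dec \<epsilon>(1) u_le[OF vw] unfolding k_u by fastforce
    show "k n (h n q) - k n (h n p) = 1" for n unfolding k_u by (rule peak)
    show "(\<Sum>j\<in>{..<N} - {n}. \<bar>k j (h n q) - k j (h n p)\<bar>) \<le> 1/2" for n N
    proof -
      have "(\<Sum>j\<in>{..<N} - {n}. \<bar>u (h j) (h n p, h n q)\<bar>) \<le> (\<Sum>j\<in>{..<N} - {n}. \<epsilon> j)"
        by (rule sum_of_almost_disjoint_off_peak[where m = n, OF hump[OF _ edge] dec])
          (use peak \<epsilon>(2) in auto)
      then show ?thesis unfolding k_u using sum_\<epsilon>[of "{..<N} - {n}"] by simp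
    qed
  qed
  then show ?thesis by blast
qed


section \<open>The dual of the Lipschitz space and the free space\<close>

lemma dual_ops [simp]:
  "vadd (dual_nspace A) = (\<lambda>\<phi> \<psi> x. \<phi> x + \<psi> x)"
  "vscale (dual_nspace A) = (\<lambda>c \<phi> x. c * \<phi> x)"
  by (simp_all add: dual_nspace_def)

lemma dual_mem_iff:
  "z \<in> vecs (dual_nspace (Lip0 E v0)) \<longleftrightarrow>
     (\<forall>f. f \<notin> vecs (Lip0 E v0) \<longrightarrow> z f = 0) \<and>
     (\<forall>f\<in>vecs (Lip0 E v0). \<forall>g\<in>vecs (Lip0 E v0). z (\<lambda>x. f x + g x) = z f + z g) \<and>
     (\<forall>c. \<forall>f\<in>vecs (Lip0 E v0). z (\<lambda>x. c * f x) = c * z f) \<and>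
     (\<exists>C. \<forall>f\<in>vecs (Lip0 E v0). \<bar>z f\<bar> \<le> C * vnorm (Lip0 E v0) f)"
  by (simp add: dual_nspace_def)

lemma Lip0_norm_nonneg: "f \<in> vecs (Lip0 E v0) \<Longrightarrow> 0 \<le> vnorm (Lip0 E v0) f"
  using Lip0_norm_attained[of f E v0] by (simp add: lip_bound_def)

text \<open>
  Norms in the dual are estimated throughout by testing against functions with an arbitrary
  Lipschitz bound \<open>B\<close>, which avoids normalising to the unit ball.
\<close>

lemma dual_norm_le:
  assumes "0 \<le> D" and z: "\<And>f B. f \<in> vecs (Lip0 E v0) \<Longrightarrow> lip_bound E f B \<Longrightarrow> \<bar>z f\<bar> \<le> D * B"
  shows "vnorm (dual_nspace (Lip0 E v0)) z \<le> D"
proof -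
  have "lip_bound E (\<lambda>_. 0) 0" by (simp add: lip_bound_def)
  then have "(\<lambda>_. 0) \<in> {f \<in> vecs (Lip0 E v0). vnorm (Lip0 E v0) f \<le> 1}"
    using Lip0_norm_le[of E "\<lambda>_. 0" 0 v0] Lip0_memI[of "\<lambda>_. 0" v0 E 0] by auto
  then have "{f \<in> vecs (Lip0 E v0). vnorm (Lip0 E v0) f \<le> 1} \<noteq> {}" by blast
  moreover have "\<bar>z f\<bar> \<le> D" if "f \<in> vecs (Lip0 E v0)" "vnorm (Lip0 E v0) f \<le> 1" for f
    using z[OF that(1) Lip0_norm_attained[OF that(1)]] mult_left_mono[OF that(2) \<open>0 \<le> D\<close>]
    by simp
  ultimately show ?thesis
    unfolding dual_nspace_def by (simp del: empty_Collect_eq) (intro cSUP_least, auto)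
qed

lemma
  assumes z: "z \<in> vecs (dual_nspace (Lip0 E v0))"
  shows dual_norm_nonneg: "0 \<le> vnorm (dual_nspace (Lip0 E v0)) z"
    and dual_pairing_le: "\<And>f B. f \<in> vecs (Lip0 E v0) \<Longrightarrow> lip_bound E f B \<Longrightarrow>
      \<bar>z f\<bar> \<le> vnorm (dual_nspace (Lip0 E v0)) z * B"
proof -
  let ?L = "Lip0 E v0" and ?n = "vnorm (dual_nspace (Lip0 E v0)) z"
  obtain C where C: "\<And>f. f \<in> vecs ?L \<Longrightarrow> \<bar>z f\<bar> \<le> C * vnorm ?L f"
    using z unfolding dual_mem_iff by blast
  have "\<bar>z f\<bar> \<le> \<bar>C\<bar>" if "f \<in> vecs ?L" "vnorm ?L f \<le> 1" for f
  proof -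
    have "\<bar>z f\<bar> \<le> \<bar>C\<bar> * vnorm ?L f"
      using C[OF that(1)] mult_right_mono[OF abs_ge_self[of C] Lip0_norm_nonneg[OF that(1)]] by linarith
    also have "\<dots> \<le> \<bar>C\<bar> * 1" using that(2) by (intro mult_left_mono) auto
    finally show ?thesis by simp
  qed
  then have "bdd_above ((\<lambda>f. \<bar>z f\<bar>) ` {f \<in> vecs ?L. vnorm ?L f \<le> 1})"
    by (intro bdd_aboveI[of _ "\<bar>C\<bar>"]) auto
  then have unit: "\<bar>z f\<bar> \<le> ?n" if "f \<in> vecs ?L" "vnorm ?L f \<le> 1" for f
    using that unfolding dual_nspace_def by (auto intro!: cSUP_upper)
  have "lip_bound E (\<lambda>_. 0) 0" by (simp add: lip_bound_def)
  then have "\<bar>z (\<lambda>_. 0)\<bar> \<le> ?n"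
    using Lip0_norm_le[of E "\<lambda>_. 0" 0 v0] Lip0_memI[of "\<lambda>_. 0" v0 E 0] by (intro unit) auto
  then show "0 \<le> ?n" by linarith
  fix f B assume f: "f \<in> vecs ?L" "lip_bound E f B"
  show "\<bar>z f\<bar> \<le> ?n * B"
  proof (cases "B = 0")
    case True
    then have "vnorm ?L f = 0"
      using Lip0_norm_le[OF f(2), of v0] Lip0_norm_nonneg[OF f(1)] by simp
    then show ?thesis using C[OF f(1)] True by simp
  next
    case False
    then have B: "0 < B" using f(2) by (simp add: lip_bound_def)
    have "vnorm ?L (\<lambda>x. (1/B) * f x) \<le> \<bar>1/B\<bar> * B"
      by (rule Lip0_norm_le) (rule lip_bound_scale[OF f(2)])
    then have "\<bar>z (\<lambda>x. (1/B) * f x)\<bar> \<le> ?n"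
      using B by (intro unit Lip0_closed(2) f(1)) auto
    also have "z (\<lambda>x. (1/B) * f x) = (1/B) * z f"
      using z f(1) unfolding dual_mem_iff by blast
    finally have "\<bar>z f\<bar> / B \<le> ?n" using B by (simp add: abs_mult)
    then show ?thesis using B by (simp add: pos_divide_le_eq)
  qed
qed

lemma dual_memI:
  assumes "\<And>f. f \<notin> vecs (Lip0 E v0) \<Longrightarrow> z f = 0"
    and "\<And>f g. f \<in> vecs (Lip0 E v0) \<Longrightarrow> g \<in> vecs (Lip0 E v0) \<Longrightarrow> z (\<lambda>x. f x + g x) = z f + z g"
    and "\<And>c f. f \<in> vecs (Lip0 E v0) \<Longrightarrow> z (\<lambda>x. c * f x) = c * z f"
    and "\<And>f B. f \<in> vecs (Lip0 E v0) \<Longrightarrow> lip_bound E f B \<Longrightarrow> \<bar>z f\<bar> \<le> D * B"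
  shows "z \<in> vecs (dual_nspace (Lip0 E v0))"
proof -
  have "\<bar>z f\<bar> \<le> D * vnorm (Lip0 E v0) f" if "f \<in> vecs (Lip0 E v0)" for f
    using assms(4)[OF that Lip0_norm_attained[OF that]] .
  with assms(1-3) show ?thesis unfolding dual_mem_iff by blast
qed

lemma dual_closed:
  assumes z: "z \<in> vecs (dual_nspace (Lip0 E v0))"
  shows "w \<in> vecs (dual_nspace (Lip0 E v0)) \<Longrightarrow>
      (\<lambda>f. z f + w f) \<in> vecs (dual_nspace (Lip0 E v0))"
    and "(\<lambda>f. c * z f) \<in> vecs (dual_nspace (Lip0 E v0))"
proof -
  let ?n = "vnorm (dual_nspace (Lip0 E v0))"
  assume w: "w \<in> vecs (dual_nspace (Lip0 E v0))"
  show "(\<lambda>f. z f + w f) \<in> vecs (dual_nspace (Lip0 E v0))"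
  proof (rule dual_memI[where D = "?n z + ?n w"])
    fix f B assume "f \<in> vecs (Lip0 E v0)" "lip_bound E f B"
    then show "\<bar>z f + w f\<bar> \<le> (?n z + ?n w) * B"
      using dual_pairing_le[OF z, of f B] dual_pairing_le[OF w, of f B] by (simp add: distrib_right)
  qed (use z w in \<open>auto simp: dual_mem_iff algebra_simps\<close>)
next
  let ?n = "vnorm (dual_nspace (Lip0 E v0))"
  show "(\<lambda>f. c * z f) \<in> vecs (dual_nspace (Lip0 E v0))"
  proof (rule dual_memI[where D = "\<bar>c\<bar> * ?n z"])
    fix f B assume "f \<in> vecs (Lip0 E v0)" "lip_bound E f B"
    then show "\<bar>c * z f\<bar> \<le> (\<bar>c\<bar> * ?n z) * B"
      using dual_pairing_le[OF z, of f B] by (simp add: abs_mult mult.assoc mult_left_mono)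
  qed (use z in \<open>auto simp: dual_mem_iff algebra_simps\<close>)
qed

lemma molecules_eval: "eval_at E v0 v \<in> molecules E v0"
  unfolding molecules_def by (rule CollectI, rule exI[of _ "{v}"], rule exI[of _ "\<lambda>_. 1"]) simp

lemma molecules_zero: "(\<lambda>_. 0) \<in> molecules E v0"
  unfolding molecules_def by (rule CollectI, rule exI[of _ "{}"]) simp

lemma molecules_add:
  assumes "m \<in> molecules E v0" "m' \<in> molecules E v0"
  shows "(\<lambda>f. m f + m' f) \<in> molecules E v0"
proof -
  obtain S a S' a' where S: "finite S" "m = (\<lambda>f. \<Sum>v\<in>S. a v * eval_at E v0 v f)"
    and S': "finite S'" "m' = (\<lambda>f. \<Sum>v\<in>S'. a' v * eval_at E v0 v f)"
    using assms unfolding molecules_def by blast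
  define c where "c = (\<lambda>v. (if v \<in> S then a v else 0) + (if v \<in> S' then a' v else 0))"
  have "m f + m' f = (\<Sum>v\<in>S \<union> S'. c v * eval_at E v0 v f)" for f
  proof -
    have "(\<Sum>v\<in>S. a v * eval_at E v0 v f) = (\<Sum>v\<in>S \<union> S'. (if v \<in> S then a v else 0) * eval_at E v0 v f)"
      using S(1) S'(1) by (intro sum.mono_neutral_cong_left) auto
    moreover have "(\<Sum>v\<in>S'. a' v * eval_at E v0 v f) = (\<Sum>v\<in>S \<union> S'. (if v \<in> S' then a' v else 0) * eval_at E v0 v f)"
      using S(1) S'(1) by (intro sum.mono_neutral_cong_left) auto
    ultimately show ?thesis by (simp add: S(2) S'(2) c_def distrib_right sum.distrib)
  qed
  then show ?thesis
    unfolding molecules_def using S(1) S'(1)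
    by (intro CollectI exI[of _ "S \<union> S'"] exI[of _ c]) auto
qed

lemma molecules_scale:
  assumes "m \<in> molecules E v0"
  shows "(\<lambda>f. r * m f) \<in> molecules E v0"
proof -
  obtain S a where S: "finite S" "m = (\<lambda>f. \<Sum>v\<in>S. a v * eval_at E v0 v f)"
    using assms unfolding molecules_def by blast
  then show ?thesis
    unfolding molecules_def
    by (intro CollectI exI[of _ S] exI[of _ "\<lambda>v. r * a v"]) (auto simp: sum_distrib_left mult.assoc)
qed

lemma eval_at_dual: "eval_at E v0 v \<in> vecs (dual_nspace (Lip0 E v0))"
proof (rule dual_memI[where D = "real (gdist E v v0)"])
  fix f B assume f: "f \<in> vecs (Lip0 E v0)" "lip_bound E f B"
  then have "\<bar>f v - f v0\<bar> \<le> B * real (gdist E v v0)" by (simp add: lip_bound_def)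
  moreover have "f v0 = 0" using f(1) by (simp add: Lip0_def)
  ultimately show "\<bar>eval_at E v0 v f\<bar> \<le> real (gdist E v v0) * B"
    using f(1) by (simp add: eval_at_def mult.commute)
qed (auto simp: eval_at_def Lip0_closed)

lemma molecules_dual:
  assumes "m \<in> molecules E v0"
  shows "m \<in> vecs (dual_nspace (Lip0 E v0))"
proof -
  obtain S a where S: "finite S" "m = (\<lambda>f. \<Sum>v\<in>S. a v * eval_at E v0 v f)"
    using assms unfolding molecules_def by blast
  from S(1) have "(\<lambda>f. \<Sum>v\<in>S. a v * eval_at E v0 v f) \<in> vecs (dual_nspace (Lip0 E v0))"
  proof induction
    case empty
    show ?case by (rule dual_memI[where D = 0]) auto
  next
    case (insert v S)
    have "(\<lambda>f. a v * eval_at E v0 v f) \<in> vecs (dual_nspace (Lip0 E v0))"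
      by (rule dual_closed(2)[OF eval_at_dual])
    from dual_closed(1)[OF this insert.IH] insert.hyps show ?case by simp
  qed
  with S(2) show ?thesis by simp
qed

lemma free_space_ops [simp]:
  "vadd (free_space E v0) = (\<lambda>\<phi> \<psi> x. \<phi> x + \<psi> x)"
  "vscale (free_space E v0) = (\<lambda>c \<phi> x. c * \<phi> x)"
  "vnorm (free_space E v0) = vnorm (dual_nspace (Lip0 E v0))"
  by (simp_all add: free_space_def subspace_of_def)

text \<open>
  The approximation by molecules, with the dual norm replaced by the estimate on functions.
\<close>

lemma free_space_mem_iff:
  "z \<in> vecs (free_space E v0) \<longleftrightarrow> z \<in> vecs (dual_nspace (Lip0 E v0)) \<and>
    (\<forall>\<epsilon>>0. \<exists>m\<in>molecules E v0. \<forall>f\<in>vecs (Lip0 E v0). \<forall>B. lip_bound E f B \<longrightarrow> \<bar>z f - m f\<bar> \<le> \<epsilon> * B)"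
  (is "_ \<longleftrightarrow> _ \<and> ?R")
proof -
  let ?D = "dual_nspace (Lip0 E v0)"
  have "(\<forall>\<epsilon>>0. \<exists>m\<in>molecules E v0. vnorm ?D (vdiff ?D z m) < \<epsilon>) \<longleftrightarrow> ?R" (is "?L \<longleftrightarrow> _")
    if z: "z \<in> vecs ?D"
  proof
    assume L: ?L
    show ?R
    proof (intro allI impI)
      fix \<epsilon> :: real assume "0 < \<epsilon>"
      then obtain m where m: "m \<in> molecules E v0" "vnorm ?D (vdiff ?D z m) < \<epsilon>" using L by blast
      have d: "vdiff ?D z m \<in> vecs ?D"
        unfolding vdiff_def dual_ops
        by (rule dual_closed(1)[OF z dual_closed(2)[OF molecules_dual[OF m(1)]]])
      have "\<bar>z f - m f\<bar> \<le> \<epsilon> * B" if f: "f \<in> vecs (Lip0 E v0)" "lip_bound E f B" for f B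
      proof -
        have "\<bar>vdiff ?D z m f\<bar> \<le> vnorm ?D (vdiff ?D z m) * B" by (rule dual_pairing_le[OF d f])
        also have "\<dots> \<le> \<epsilon> * B"
          using m(2) f(2) by (intro mult_right_mono) (auto simp: lip_bound_def)
        finally show ?thesis by (simp add: vdiff_def)
      qed
      with m(1) show "\<exists>m\<in>molecules E v0. \<forall>f\<in>vecs (Lip0 E v0). \<forall>B. lip_bound E f B \<longrightarrow> \<bar>z f - m f\<bar> \<le> \<epsilon> * B"
        by blast
    qed
  next
    assume R: ?R
    show ?L
    proof (intro allI impI)
      fix \<epsilon> :: real assume "0 < \<epsilon>"
      then have "0 < \<epsilon>/2" by simp
      from R[THEN spec, THEN mp, OF this] obtain m where m: "m \<in> molecules E v0"
        "\<And>f B. f \<in> vecs (Lip0 E v0) \<Longrightarrow> lip_bound E f B \<Longrightarrow> \<bar>z f - m f\<bar> \<le> \<epsilon>/2 * B"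
        by blast
      have "vnorm ?D (vdiff ?D z m) \<le> \<epsilon>/2"
        using m(2) \<open>0 < \<epsilon>\<close> by (intro dual_norm_le) (auto simp: vdiff_def)
      with m(1) \<open>0 < \<epsilon>\<close> show "\<exists>m\<in>molecules E v0. vnorm ?D (vdiff ?D z m) < \<epsilon>"
        by (intro bexI[of _ m]) auto
    qed
  qed
  then show ?thesis by (auto simp: free_space_def subspace_of_def)
qed

lemma free_space_dual: "z \<in> vecs (free_space E v0) \<Longrightarrow> z \<in> vecs (dual_nspace (Lip0 E v0))"
  by (simp add: free_space_mem_iff)

lemma free_space_approx:
  assumes "z \<in> vecs (free_space E v0)" "0 < \<epsilon>"
  obtains m where "m \<in> molecules E v0"
    "\<And>f B. f \<in> vecs (Lip0 E v0) \<Longrightarrow> lip_bound E f B \<Longrightarrow> \<bar>z f - m f\<bar> \<le> \<epsilon> * B"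
proof -
  note app = assms(1)[unfolded free_space_mem_iff, THEN conjunct2, THEN spec, THEN mp, OF assms(2)]
  show thesis using app that by blast
qed

lemma free_space_closed:
  assumes z: "z \<in> vecs (free_space E v0)"
  shows "w \<in> vecs (free_space E v0) \<Longrightarrow> (\<lambda>f. z f + w f) \<in> vecs (free_space E v0)"
    and "(\<lambda>f. c * z f) \<in> vecs (free_space E v0)"
proof -
  assume w: "w \<in> vecs (free_space E v0)"
  show "(\<lambda>f. z f + w f) \<in> vecs (free_space E v0)"
    unfolding free_space_mem_iff
  proof (intro conjI allI impI)
    show "(\<lambda>f. z f + w f) \<in> vecs (dual_nspace (Lip0 E v0))"
      by (rule dual_closed(1)[OF free_space_dual[OF z] free_space_dual[OF w]])
    fix \<epsilon> :: real assume "0 < \<epsilon>"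
    then have e: "0 < \<epsilon>/2" by simp
    obtain m where m: "m \<in> molecules E v0"
      "\<And>f B. f \<in> vecs (Lip0 E v0) \<Longrightarrow> lip_bound E f B \<Longrightarrow> \<bar>z f - m f\<bar> \<le> \<epsilon>/2 * B"
      by (rule free_space_approx[OF z e]) blast
    obtain m' where m': "m' \<in> molecules E v0"
      "\<And>f B. f \<in> vecs (Lip0 E v0) \<Longrightarrow> lip_bound E f B \<Longrightarrow> \<bar>w f - m' f\<bar> \<le> \<epsilon>/2 * B"
      by (rule free_space_approx[OF w e]) blast
    have "\<bar>z f + w f - (m f + m' f)\<bar> \<le> \<epsilon> * B" if "f \<in> vecs (Lip0 E v0)" "lip_bound E f B" for f B
      using m(2)[OF that] m'(2)[OF that] by linarith
    then show "\<exists>m\<in>molecules E v0. \<forall>f\<in>vecs (Lip0 E v0). \<forall>B. lip_bound E f B \<longrightarrow> \<bar>z f + w f - m f\<bar> \<le> \<epsilon> * B"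
      by (intro bexI[OF _ molecules_add[OF m(1) m'(1)]]) auto
  qed
next
  show "(\<lambda>f. c * z f) \<in> vecs (free_space E v0)"
    unfolding free_space_mem_iff
  proof (intro conjI allI impI)
    show "(\<lambda>f. c * z f) \<in> vecs (dual_nspace (Lip0 E v0))"
      using dual_closed(2)[OF free_space_dual[OF z]] .
    fix \<epsilon> :: real assume "0 < \<epsilon>"
    then have e: "0 < \<epsilon> / (\<bar>c\<bar> + 1)" by simp
    obtain m where m: "m \<in> molecules E v0"
      "\<And>f B. f \<in> vecs (Lip0 E v0) \<Longrightarrow> lip_bound E f B \<Longrightarrow> \<bar>z f - m f\<bar> \<le> \<epsilon> / (\<bar>c\<bar> + 1) * B"
      by (rule free_space_approx[OF z e]) blast
    have "\<bar>c * z f - c * m f\<bar> \<le> \<epsilon> * B" if f: "f \<in> vecs (Lip0 E v0)" "lip_bound E f B" for f B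
    proof -
      have "\<bar>c * z f - c * m f\<bar> = \<bar>c\<bar> * \<bar>z f - m f\<bar>"
        by (simp add: abs_mult flip: right_diff_distrib)
      also have "\<dots> \<le> (\<bar>c\<bar> + 1) * (\<epsilon> / (\<bar>c\<bar> + 1) * B)"
        using m(2)[OF f] by (intro mult_mono) auto
      also have "\<dots> = (\<bar>c\<bar> + 1) / (\<bar>c\<bar> + 1) * (\<epsilon> * B)" by simp
      also have "(\<bar>c\<bar> + 1) / (\<bar>c\<bar> + 1) = 1" by (rule divide_self) linarith
      finally show ?thesis by simp
    qed
    then show "\<exists>m\<in>molecules E v0. \<forall>f\<in>vecs (Lip0 E v0). \<forall>B. lip_bound E f B \<longrightarrow> \<bar>c * z f - m f\<bar> \<le> \<epsilon> * B"
      by (intro bexI[OF _ molecules_scale[OF m(1), of c]]) auto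
  qed
qed

lemma preannihilator_zero: "(\<lambda>_. 0) \<in> preannihilator E v0 X"
proof -
  have "(\<lambda>_. 0) \<in> vecs (dual_nspace (Lip0 E v0))" by (rule molecules_dual[OF molecules_zero])
  then have "(\<lambda>_. 0) \<in> vecs (free_space E v0)"
    unfolding free_space_mem_iff using molecules_zero
    by (auto intro!: bexI[of _ "\<lambda>_. 0"] simp: lip_bound_def)
  then show ?thesis by (simp add: preannihilator_def)
qed

lemma preannihilator_closed:
  assumes "m \<in> preannihilator E v0 X"
  shows "n \<in> preannihilator E v0 X \<Longrightarrow> (\<lambda>f. m f + n f) \<in> preannihilator E v0 X"
    and "(\<lambda>f. c * m f) \<in> preannihilator E v0 X"
  using assms free_space_closed[of m] by (auto simp: preannihilator_def)


section \<open>The quotient of the free space\<close>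

definition free_coset ::
    "('v \<times> 'v) set \<Rightarrow> 'v \<Rightarrow> ('v \<Rightarrow> real) set \<Rightarrow> (('v \<Rightarrow> real) \<Rightarrow> real) \<Rightarrow> (('v \<Rightarrow> real) \<Rightarrow> real) set" where
  "free_coset E v0 X = coset (free_space E v0) (preannihilator E v0 X)"

lemma free_space_mod_vecs: "vecs (free_space_mod E v0 X) = free_coset E v0 X ` vecs (free_space E v0)"
  by (simp add: free_space_mod_def quotient_nspace_def free_coset_def)

lemma free_coset_mem: "w \<in> free_coset E v0 X z \<longleftrightarrow> (\<exists>n\<in>preannihilator E v0 X. w = (\<lambda>f. z f + n f))"
  by (auto simp: free_coset_def coset_def)

lemma free_coset_self: "z \<in> free_coset E v0 X z"
  unfolding free_coset_mem by (rule bexI[OF _ preannihilator_zero]) simp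

lemma free_space_mod_add:
  "vadd (free_space_mod E v0 X) (free_coset E v0 X z) (free_coset E v0 X w) =
     free_coset E v0 X (\<lambda>f. z f + w f)"
proof -
  have "{\<lambda>f. p f + q f | p q. p \<in> free_coset E v0 X z \<and> q \<in> free_coset E v0 X w}
    = free_coset E v0 X (\<lambda>f. z f + w f)" (is "?A = ?B")
  proof
    show "?A \<subseteq> ?B"
    proof
      fix r assume "r \<in> ?A"
      then obtain m n where mn: "m \<in> preannihilator E v0 X" "n \<in> preannihilator E v0 X"
        "r = (\<lambda>f. (z f + m f) + (w f + n f))"
        by (auto simp: free_coset_mem)
      from mn(3) have "r = (\<lambda>f. (z f + w f) + (m f + n f))" by (simp add: algebra_simps)
      then show "r \<in> ?B"
        unfolding free_coset_mem by (rule bexI[OF _ preannihilator_closed(1)[OF mn(1,2)]])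
    qed
    show "?B \<subseteq> ?A"
    proof
      fix r assume "r \<in> ?B"
      then obtain n where n: "n \<in> preannihilator E v0 X" "r = (\<lambda>f. (z f + w f) + n f)"
        by (auto simp: free_coset_mem)
      have "(\<lambda>f. w f + n f) \<in> free_coset E v0 X w" using n(1) by (auto simp: free_coset_mem)
      moreover have "r = (\<lambda>f. z f + (w f + n f))" using n(2) by (simp add: algebra_simps)
      ultimately show "r \<in> ?A"
        by (intro CollectI exI[of _ z] exI[of _ "\<lambda>f. w f + n f"] conjI free_coset_self)
    qed
  qed
  then show ?thesis by (simp add: free_space_mod_def quotient_nspace_def)
qed

lemma free_space_mod_scale:
  "vscale (free_space_mod E v0 X) c (free_coset E v0 X z) = free_coset E v0 X (\<lambda>f. c * z f)"
proof -
  have "{\<lambda>f. c * p f + n f | p n. p \<in> free_coset E v0 X z \<and> n \<in> preannihilator E v0 X}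
    = free_coset E v0 X (\<lambda>f. c * z f)" (is "?A = ?B")
  proof
    show "?A \<subseteq> ?B"
    proof
      fix r assume "r \<in> ?A"
      then obtain m n where mn: "m \<in> preannihilator E v0 X" "n \<in> preannihilator E v0 X"
        "r = (\<lambda>f. c * (z f + m f) + n f)"
        by (auto simp: free_coset_mem)
      from mn(3) have "r = (\<lambda>f. c * z f + (c * m f + n f))" by (simp add: algebra_simps)
      then show "r \<in> ?B"
        unfolding free_coset_mem
        by (rule bexI[OF _ preannihilator_closed(1)[OF preannihilator_closed(2)[OF mn(1)] mn(2)]])
    qed
    show "?B \<subseteq> ?A"
    proof
      fix r assume "r \<in> ?B"
      then obtain n where "n \<in> preannihilator E v0 X" "r = (\<lambda>f. c * z f + n f)"
        by (auto simp: free_coset_mem)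
      then show "r \<in> ?A" by (intro CollectI exI[of _ z] exI[of _ n] conjI free_coset_self)
    qed
  qed
  then show ?thesis by (simp add: free_space_mod_def quotient_nspace_def)
qed

lemma free_coset_subset:
  assumes "z \<in> vecs (free_space E v0)" "w \<in> free_coset E v0 X z"
  shows "w \<in> vecs (free_space E v0)"
  using assms by (auto simp: free_coset_mem preannihilator_def intro: free_space_closed(1))

lemma free_space_mod_norm:
  "vnorm (free_space_mod E v0 X) P = Inf (vnorm (free_space E v0) ` P)"
  by (simp add: free_space_mod_def quotient_nspace_def)

lemma free_space_mod_norm_le:
  assumes "z \<in> vecs (free_space E v0)"
  shows "vnorm (free_space_mod E v0 X) (free_coset E v0 X z) \<le> vnorm (free_space E v0) z"
  unfolding free_space_mod_norm
proof (rule cINF_lower[OF _ free_coset_self])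
  show "bdd_below (vnorm (free_space E v0) ` free_coset E v0 X z)"
    using dual_norm_nonneg[OF free_space_dual[OF free_coset_subset[OF assms]]]
    by (intro bdd_belowI[of _ 0]) auto
qed

lemma free_space_mod_norm_ge:
  assumes "\<And>w. w \<in> free_coset E v0 X z \<Longrightarrow> D \<le> vnorm (free_space E v0) w"
  shows "D \<le> vnorm (free_space_mod E v0 X) (free_coset E v0 X z)"
  unfolding free_space_mod_norm
proof (rule cINF_greatest)
  show "free_coset E v0 X z \<noteq> {}" using free_coset_self[of z E v0 X] by blast
qed (rule assms)


section \<open>Consequences of gradient interpolation\<close>

lemma linf_norm: "bounded (range b) \<Longrightarrow> \<bar>b n\<bar> \<le> vnorm linf b"
  unfolding linf_def by (auto simp: bounded_iff intro!: cSUP_upper bdd_aboveI2)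

lemma bounded_unit: "bounded (range (\<lambda>n. if n = i then 1 else 0 :: real))" for i :: nat
  unfolding bounded_range_iff_abs by (intro exI[of _ 1]) auto

context gradient_interpolation
begin

lemma X_Lip0: "f \<in> X \<Longrightarrow> f \<in> vecs (Lip0 E v0)"
  using subspace by (auto simp: linear_subspace_def)

lemma C_ge_1: "1 \<le> C"
proof -
  have "lip_bound E (W (\<lambda>_. 1)) (C * 1)" by (rule W_bound) simp
  from lip_bound_edge[OF this edge[of 0]] show ?thesis using W_interp[of "\<lambda>_. 1" 0] by simp
qed

text \<open>
  \<open>W\<close> is bounded below because a Lipschitz constant dominates every gradient along an edge.
\<close>

lemma linf_embeds: "embeds_isomorphically linf (subspace_of (Lip0 E v0) X)"
proof -
  let ?S = "subspace_of (Lip0 E v0) X"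
  have vec: "b \<in> vecs linf \<longleftrightarrow> bounded (range b)" for b by (simp add: linf_def)
  have "linear_op linf ?S W"
    unfolding linear_op_def vec by (auto simp: vec W_mem W_add W_scale subspace_of_def linf_def)
  moreover have "vnorm ?S (W b) \<le> C * vnorm linf b" if "b \<in> vecs linf" for b
    using Lip0_norm_le[OF W_bound[of b "vnorm linf b"]] linf_norm that
    by (simp add: subspace_of_def vec)
  moreover have "1 * vnorm linf b \<le> vnorm ?S (W b)" if "b \<in> vecs linf" for b
  proof -
    have b: "bounded (range b)" using that by (simp add: vec)
    have "\<bar>b n\<bar> \<le> vnorm (Lip0 E v0) (W b)" for n
      using lip_bound_edge[OF Lip0_norm_attained[OF X_Lip0[OF W_mem[OF b]]] edge[of n]] W_interp[OF b, of n]
      by simp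
    then show ?thesis by (auto simp: linf_def subspace_of_def intro!: cSUP_least)
  qed
  ultimately show ?thesis
    unfolding embeds_isomorphically_def iso_embedding_def bounded_op_def
    by (intro exI[of _ W] conjI) (auto intro: exI[of _ C] exI[of _ 1])
qed

text \<open>
  The images of the indicator sequences of the subsets of \<open>\<nat>\<close> are at mutual distance at least 1,
  so a dense set contains at least as many elements as there are subsets.
\<close>

lemma not_separable: "\<not> separable_nspace (subspace_of (Lip0 E v0) X)"
proof
  define g where "g = (\<lambda>A. W (\<lambda>n. if n \<in> A then 1 else 0))"
  have bd: "bounded (range (\<lambda>n. if n \<in> A then 1 else 0 :: real))" for A :: "nat set"
    unfolding bounded_range_iff_abs by (intro exI[of _ 1]) auto
  assume "separable_nspace (subspace_of (Lip0 E v0) X)"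
  then obtain D where D: "countable D" "D \<subseteq> X"
    and dense: "\<And>f \<epsilon>. f \<in> X \<Longrightarrow> 0 < \<epsilon> \<Longrightarrow>
      \<exists>d\<in>D. vnorm (Lip0 E v0) (vdiff (subspace_of (Lip0 E v0) X) f d) < \<epsilon>"
    by (auto simp: separable_nspace_def subspace_of_def)
  have gX: "g A \<in> X" for A unfolding g_def by (rule W_mem[OF bd])
  have "\<exists>d\<in>D. vnorm (Lip0 E v0) (\<lambda>v. g A v + (-1) * d v) < 1/2" for A
    using dense[OF gX, of "1/2" A] by (simp add: vdiff_def subspace_of_def)
  then obtain d where d: "\<And>A. d A \<in> D" "\<And>A. vnorm (Lip0 E v0) (\<lambda>v. g A v + (-1) * d A v) < 1/2"
    by metis
  have near: "\<bar>(g A (y n) - g A (x n)) - (d A (y n) - d A (x n))\<bar> < 1/2" for A n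
  proof -
    have "(\<lambda>v. g A v + (-1) * d A v) \<in> vecs (Lip0 E v0)"
      using gX d(1) D(2) by (intro Lip0_closed(1)[OF _ Lip0_closed(2)] X_Lip0) auto
    from lip_bound_edge[OF Lip0_norm_attained[OF this] edge[of n]] d(2)[of A]
    show ?thesis by (simp add: algebra_simps)
  qed
  have "inj d"
  proof (rule injI)
    fix A B assume eq: "d A = d B"
    have g: "g A (y n) - g A (x n) = (if n \<in> A then 1 else 0)" for A n
      unfolding g_def by (rule W_interp[OF bd])
    have "n \<in> A \<longleftrightarrow> n \<in> B" for n
      using near[of A n] near[of B n] unfolding g eq by (auto simp: abs_if split: if_splits)
    then show "A = B" by blast
  qed
  moreover have "countable (range d)" using d(1) by (intro countable_subset[OF _ D(1)]) auto
  ultimately have "countable (UNIV :: nat set set)" by (rule countable_image_inj_on[rotated])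
  then obtain F :: "nat \<Rightarrow> nat set" where "range F = UNIV"
    by (metis UNIV_not_empty uncountable_def)
  then show False using Cantors_theorem[of "UNIV :: nat set"] by auto
qed

text \<open>
  The element \<open>\<Sum> a n * (\<delta>(y n) - \<delta>(x n))\<close> of the free space, for \<open>a\<close> in \<open>\<ell>\<^sub>1\<close>; like every
  functional of the dual space it is extended by 0.
\<close>

definition series_molecule :: "(nat \<Rightarrow> real) \<Rightarrow> ('v \<Rightarrow> real) \<Rightarrow> real" where
  "series_molecule a = (\<lambda>f. if f \<in> vecs (Lip0 E v0) then \<Sum>n. (f (y n) - f (x n)) * a n else 0)"

lemma series_molecule_summable:
  assumes a: "summable (\<lambda>n. \<bar>a n\<bar>)" and f: "lip_bound E f B"
  shows "summable (\<lambda>n. (f (y n) - f (x n)) * a n)"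
    and "\<bar>\<Sum>n. (f (y n) - f (x n)) * a n\<bar> \<le> B * (\<Sum>n. \<bar>a n\<bar>)"
proof -
  have part: "(\<Sum>j<N. \<bar>a j\<bar>) \<le> (\<Sum>n. \<bar>a n\<bar>)" for N by (rule sum_le_suminf[OF a]) auto
  note le = lip_bound_edge[OF f edge]
  show "summable (\<lambda>n. (f (y n) - f (x n)) * a n)"
    by (rule bounded_combination_of_abs_summable(2)[OF part le])
  show "\<bar>\<Sum>n. (f (y n) - f (x n)) * a n\<bar> \<le> B * (\<Sum>n. \<bar>a n\<bar>)"
    by (rule bounded_combination_of_abs_summable(3)[OF part le])
qed

lemma series_molecule_bound:
  assumes a: "summable (\<lambda>n. \<bar>a n\<bar>)" and f: "f \<in> vecs (Lip0 E v0)" "lip_bound E f B"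
  shows "\<bar>series_molecule a f\<bar> \<le> (\<Sum>n. \<bar>a n\<bar>) * B"
  using series_molecule_summable(2)[OF a f(2)] f(1) by (simp add: series_molecule_def mult.commute)

lemma series_molecule_add:
  assumes a: "summable (\<lambda>n. \<bar>a n\<bar>)" and b: "summable (\<lambda>n. \<bar>b n\<bar>)"
  shows "series_molecule (\<lambda>n. a n + b n) = (\<lambda>f. series_molecule a f + series_molecule b f)"
proof
  fix f
  show "series_molecule (\<lambda>n. a n + b n) f = series_molecule a f + series_molecule b f"
  proof (cases "f \<in> vecs (Lip0 E v0)")
    case True
    note s = series_molecule_summable(1)[OF _ Lip0_norm_attained[OF True]]
    show ?thesis
      unfolding series_molecule_def using True
      by (simp add: distrib_left suminf_add[OF s[OF a] s[OF b]])
  qed (simp add: series_molecule_def)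
qed

lemma series_molecule_scale:
  assumes a: "summable (\<lambda>n. \<bar>a n\<bar>)"
  shows "series_molecule (\<lambda>n. c * a n) = (\<lambda>f. c * series_molecule a f)"
proof
  fix f
  show "series_molecule (\<lambda>n. c * a n) f = c * series_molecule a f"
  proof (cases "f \<in> vecs (Lip0 E v0)")
    case True
    note s = series_molecule_summable(1)[OF a Lip0_norm_attained[OF True]]
    show ?thesis
      unfolding series_molecule_def using True suminf_mult[OF s, of c]
      by (simp add: mult_ac)
  qed (simp add: series_molecule_def)
qed

lemma series_molecule_dual:
  assumes a: "summable (\<lambda>n. \<bar>a n\<bar>)"
  shows "series_molecule a \<in> vecs (dual_nspace (Lip0 E v0))"
proof (rule dual_memI[where D = "\<Sum>n. \<bar>a n\<bar>"])
  fix f g :: "'v \<Rightarrow> real" and c B :: real assume f: "f \<in> vecs (Lip0 E v0)"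
  note s = series_molecule_summable(1)[OF a Lip0_norm_attained]
  show "series_molecule a (\<lambda>x. c * f x) = c * series_molecule a f"
    using f Lip0_closed(2)[OF f, of c] suminf_mult[OF s[OF f], of c]
    by (simp add: series_molecule_def mult.assoc flip: right_diff_distrib)
  show "lip_bound E f B \<Longrightarrow> \<bar>series_molecule a f\<bar> \<le> (\<Sum>n. \<bar>a n\<bar>) * B"
    by (rule series_molecule_bound[OF a f])
  assume g: "g \<in> vecs (Lip0 E v0)"
  have "(\<Sum>n. (f (y n) + g (y n) - (f (x n) + g (x n))) * a n)
      = (\<Sum>n. (f (y n) - f (x n)) * a n + (g (y n) - g (x n)) * a n)"
    by (intro suminf_cong) (simp add: algebra_simps)
  then show "series_molecule a (\<lambda>x. f x + g x) = series_molecule a f + series_molecule a g"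
    using f g Lip0_closed(1)[OF f g] suminf_add[OF s[OF f] s[OF g]]
    by (simp add: series_molecule_def)
qed (simp add: series_molecule_def)

lemma series_molecule_norm:
  "summable (\<lambda>n. \<bar>a n\<bar>) \<Longrightarrow> vnorm (free_space E v0) (series_molecule a) \<le> (\<Sum>n. \<bar>a n\<bar>)"
  by (auto intro!: dual_norm_le series_molecule_bound suminf_nonneg)

text \<open>The tail of the series over \<open>n \<ge> N\<close> is the series with the first \<open>N\<close> coefficients erased.\<close>

lemma series_molecule_free:
  assumes a: "summable (\<lambda>n. \<bar>a n\<bar>)"
  shows "series_molecule a \<in> vecs (free_space E v0)"
  unfolding free_space_mem_iff
proof (intro conjI allI impI series_molecule_dual[OF a])
  fix \<epsilon> :: real assume "0 < \<epsilon>"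
  have "(\<lambda>N. (\<Sum>n. \<bar>a n\<bar>) - (\<Sum>n<N. \<bar>a n\<bar>)) \<longlonglongrightarrow> (\<Sum>n. \<bar>a n\<bar>) - (\<Sum>n. \<bar>a n\<bar>)"
    by (intro tendsto_intros summable_LIMSEQ[OF a])
  then have "\<forall>\<^sub>F N in sequentially. (\<Sum>n. \<bar>a n\<bar>) - (\<Sum>n<N. \<bar>a n\<bar>) < \<epsilon>"
    using \<open>0 < \<epsilon>\<close> by (intro order_tendstoD(2)[of _ 0]) auto
  then obtain N where N: "(\<Sum>n. \<bar>a n\<bar>) - (\<Sum>n<N. \<bar>a n\<bar>) < \<epsilon>"
    by (auto simp: eventually_sequentially)
  define t where "t = (\<lambda>n. if n < N then 0 else a n)"
  define m where "m = (\<lambda>f. \<Sum>n<N. a n * (eval_at E v0 (y n) f + (-1) * eval_at E v0 (x n) f))"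
  have t: "summable (\<lambda>n. \<bar>t n\<bar>)"
    by (rule summable_comparison_test'[OF a]) (simp add: t_def)
  have "(\<lambda>n. if n \<in> {..<N} then \<bar>a n\<bar> else 0) sums (\<Sum>n<N. \<bar>a n\<bar>)" by (rule sums_If_finite_set) simp
  from sums_add[OF this summable_sums[OF t]]
  have "(\<lambda>n. \<bar>a n\<bar>) sums ((\<Sum>n<N. \<bar>a n\<bar>) + (\<Sum>n. \<bar>t n\<bar>))"
    by (rule sums_cong[THEN iffD1, rotated]) (simp add: t_def)
  then have tail: "(\<Sum>n. \<bar>t n\<bar>) < \<epsilon>" using N by (simp add: sums_iff)
  have "(\<lambda>f. \<Sum>n<k. a n * (eval_at E v0 (y n) f + (-1) * eval_at E v0 (x n) f)) \<in> molecules E v0" for k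
  proof (induction k)
    case (Suc k)
    show ?case unfolding sum.lessThan_Suc
      by (intro molecules_add Suc molecules_scale molecules_eval)
  qed (simp add: molecules_zero)
  then have m: "m \<in> molecules E v0" by (simp add: m_def)
  have "\<bar>series_molecule a f - m f\<bar> \<le> \<epsilon> * B" if f: "f \<in> vecs (Lip0 E v0)" "lip_bound E f B" for f B
  proof -
    have "(\<lambda>n. if n \<in> {..<N} then (f (y n) - f (x n)) * a n else 0) sums
        (\<Sum>n<N. (f (y n) - f (x n)) * a n)"
      by (rule sums_If_finite_set) simp
    from sums_add[OF this summable_sums[OF series_molecule_summable(1)[OF t f(2)]]]
    have "(\<lambda>n. (f (y n) - f (x n)) * a n) sums
        ((\<Sum>n<N. (f (y n) - f (x n)) * a n) + (\<Sum>n. (f (y n) - f (x n)) * t n))"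
      by (rule sums_cong[THEN iffD1, rotated]) (simp add: t_def)
    then have "series_molecule a f = m f + series_molecule t f"
      using f(1) by (simp add: sums_iff series_molecule_def m_def eval_at_def mult.commute)
    then have "\<bar>series_molecule a f - m f\<bar> \<le> (\<Sum>n. \<bar>t n\<bar>) * B"
      using series_molecule_bound[OF t f] by simp
    also have "\<dots> \<le> \<epsilon> * B" using tail f(2) by (intro mult_right_mono) (auto simp: lip_bound_def)
    finally show ?thesis .
  qed
  with m show "\<exists>m\<in>molecules E v0. \<forall>f\<in>vecs (Lip0 E v0). \<forall>B. lip_bound E f B \<longrightarrow>
      \<bar>series_molecule a f - m f\<bar> \<le> \<epsilon> * B" by blast
qed

definition unit_image :: "nat \<Rightarrow> 'v \<Rightarrow> real" where
  "unit_image i = W (\<lambda>n. if n = i then 1 else 0)"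

lemma unit_image_mem: "unit_image i \<in> X"
  unfolding unit_image_def by (rule W_mem[OF bounded_unit])

lemma pairing_finite_combination:
  assumes z: "z \<in> vecs (free_space E v0)"
  shows "z (W (\<lambda>n. if n < N then s n else 0)) = (\<Sum>i<N. s i * z (unit_image i))"
proof -
  have bd: "bounded (range (\<lambda>n. if n < k then s n else 0))" for k
  proof -
    have "finite (range (\<lambda>n. if n < k then s n else 0))"
      by (rule finite_subset[of _ "insert 0 (s ` {..<k})"]) auto
    then show ?thesis by (rule finite_imp_bounded)
  qed
  have za: "z (\<lambda>v. f v + g v) = z f + z g" and zs: "z (\<lambda>v. c * f v) = c * z f"
    if "f \<in> X" "g \<in> X" for f g c
    using free_space_dual[OF z] X_Lip0[OF that(1)] X_Lip0[OF that(2)] unfolding dual_mem_iff by blast+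
  show ?thesis
  proof (induction N)
    case 0
    have "W (\<lambda>n. 0) = (\<lambda>v. 0 * W (\<lambda>_. 0) v)" using W_scale[OF bd[of 0], of 0] by simp
    then have "z (W (\<lambda>n. 0)) = 0 * z (W (\<lambda>_. 0))"
      using zs[OF W_mem W_mem, of "\<lambda>_. 0" "\<lambda>_. 0" 0] bd[of 0] by simp
    then show ?case by simp
  next
    case (Suc N)
    have split: "(\<lambda>n. if n < Suc N then s n else 0) =
        (\<lambda>n. (if n < N then s n else 0) + s N * (if n = N then 1 else 0))"
      by (auto simp: less_Suc_eq)
    have "W (\<lambda>n. if n < Suc N then s n else 0) =
        (\<lambda>v. W (\<lambda>n. if n < N then s n else 0) v + W (\<lambda>n. s N * (if n = N then 1 else 0)) v)"
      unfolding split by (rule W_add[OF bd bounded_range_scale[OF bounded_unit]])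
    also have "W (\<lambda>n. s N * (if n = N then 1 else 0)) = (\<lambda>v. s N * unit_image N v)"
      unfolding unit_image_def by (rule W_scale[OF bounded_unit])
    finally have "z (W (\<lambda>n. if n < Suc N then s n else 0)) =
        z (W (\<lambda>n. if n < N then s n else 0)) + z (\<lambda>v. s N * unit_image N v)"
      using za[OF W_mem[OF bd], of "\<lambda>v. s N * unit_image N v" N]
        W_mem[OF bounded_range_scale[OF bounded_unit], of "s N" N] W_scale[OF bounded_unit, of "s N" N]
      by (simp add: unit_image_def)
    then show ?case using Suc zs[OF unit_image_mem unit_image_mem] by simp
  qed
qed

text \<open>
  Choosing signs turns \<open>\<Sum>\<bar>z (unit_image i)\<bar>\<close> into the value of \<open>z\<close> at \<open>W\<close> of a sequence in the
  unit ball of \<open>\<ell>\<^sub>\<infinity>\<close>.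
\<close>

lemma coefficients_l1:
  assumes z: "z \<in> vecs (free_space E v0)"
  shows "summable (\<lambda>i. \<bar>z (unit_image i)\<bar>)"
    and "(\<Sum>i. \<bar>z (unit_image i)\<bar>) \<le> C * vnorm (free_space E v0) z"
proof -
  have part: "(\<Sum>i<N. \<bar>z (unit_image i)\<bar>) \<le> C * vnorm (free_space E v0) z" for N
  proof -
    define b where "b = (\<lambda>n. if n < N then sgn (z (unit_image n)) else 0)"
    have b: "\<bar>b n\<bar> \<le> 1" for n by (simp add: b_def abs_sgn_eq)
    have "bounded (range b)" using b by (auto simp: bounded_range_iff_abs)
    then have mem: "W b \<in> vecs (Lip0 E v0)" by (intro X_Lip0 W_mem)
    have "(\<Sum>i<N. \<bar>z (unit_image i)\<bar>) = z (W b)"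
      unfolding b_def pairing_finite_combination[OF z] by (simp add: abs_sgn mult.commute)
    also have "\<dots> \<le> \<bar>z (W b)\<bar>" by simp
    also have "\<dots> \<le> vnorm (free_space E v0) z * (C * 1)"
      using dual_pairing_le[OF free_space_dual[OF z] mem W_bound[OF b]] by simp
    finally show ?thesis by (simp add: mult.commute)
  qed
  show s: "summable (\<lambda>i. \<bar>z (unit_image i)\<bar>)"
    by (rule summableI_nonneg_bounded[OF _ part]) simp
  show "(\<Sum>i. \<bar>z (unit_image i)\<bar>) \<le> C * vnorm (free_space E v0) z"
    by (rule suminf_le_const[OF s part])
qed

lemma series_molecule_unit_image:
  assumes "summable (\<lambda>n. \<bar>a n\<bar>)"
  shows "series_molecule a (unit_image i) = a i"
proof -
  have "series_molecule a (unit_image i) = (\<Sum>n. (if n = i then 1 else 0) * a n)"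
    unfolding series_molecule_def unit_image_def W_interp[OF bounded_unit]
    using X_Lip0[OF W_mem[OF bounded_unit]] by simp
  also have "(\<lambda>n. (if n = i then 1 else 0) * a n) = (\<lambda>n. if n = i then a n else 0)" by auto
  also have "(\<Sum>n. if n = i then a n else 0) = a i" by (rule sums_unique[OF sums_single, symmetric])
  finally show ?thesis .
qed

text \<open>
  On the quotient, \<open>T\<close> sends the unit vectors to the classes of \<open>\<delta>(y n) - \<delta>(x n)\<close> and \<open>Q\<close>
  evaluates at the functions \<open>unit_image i\<close>, which lie in \<open>X\<close>. Interpolation says \<open>Q \<circ> T = id\<close>,
  so \<open>T \<circ> Q\<close> is a projection onto the range of \<open>T\<close>.
\<close>

lemma l1_complemented: "contains_complemented_copy (free_space_mod E v0 X) l1"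
proof -
  let ?M = "free_space_mod E v0 X" and ?F = "free_space E v0"
  let ?cos = "free_coset E v0 X"
  define T where "T = (\<lambda>a. ?cos (series_molecule a))"
  \<comment> \<open>elements of \<open>X\<close> take the same value at all representatives of a class\<close>
  define Q where "Q = (\<lambda>(P :: (('v \<Rightarrow> real) \<Rightarrow> real) set) i. (SOME z. z \<in> P) (unit_image i))"
  define P where "P = (\<lambda>c. T (Q c))"
  have l1: "a \<in> vecs l1 \<longleftrightarrow> summable (\<lambda>n. \<bar>a n\<bar>)" "vnorm l1 a = (\<Sum>n. \<bar>a n\<bar>)" for a
    by (simp_all add: l1_def)
  have l1_ops: "vadd l1 = (\<lambda>x y n. x n + y n)" "vscale l1 = (\<lambda>c x n. c * x n)"
    by (simp_all add: l1_def)
  have in_coset: "w (unit_image i) = z (unit_image i)" if "w \<in> ?cos z" for w z i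
    using that unit_image_mem by (auto simp: free_coset_mem preannihilator_def)
  have Q: "Q (?cos z) = (\<lambda>i. z (unit_image i))" for z
    unfolding Q_def using in_coset[OF someI[where P = "\<lambda>w. w \<in> ?cos z", OF free_coset_self]] by simp
  have Q_l1: "Q (?cos z) \<in> vecs l1" if "z \<in> vecs ?F" for z
    using coefficients_l1(1)[OF that] by (simp add: Q l1)
  have QT: "Q (T a) = a" if "a \<in> vecs l1" for a
    using that by (simp add: T_def Q l1 series_molecule_unit_image)
  have T_mem: "T a \<in> vecs ?M" if "a \<in> vecs l1" for a
    unfolding T_def free_space_mod_vecs by (intro imageI series_molecule_free) (use that l1 in simp)
  have T_add: "T (vadd l1 a b) = vadd ?M (T a) (T b)" if "a \<in> vecs l1" "b \<in> vecs l1" for a b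
    using that by (simp add: T_def l1 l1_ops free_space_mod_add series_molecule_add)
  have T_scale: "T (vscale l1 c a) = vscale ?M c (T a)" if "a \<in> vecs l1" for a c
    using that by (simp add: T_def l1 l1_ops free_space_mod_scale series_molecule_scale)
  have T_norm: "vnorm ?M (T a) \<le> vnorm l1 a" if "a \<in> vecs l1" for a
  proof -
    have a: "summable (\<lambda>n. \<bar>a n\<bar>)" using that by (simp add: l1)
    have "vnorm ?M (T a) \<le> vnorm ?F (series_molecule a)"
      unfolding T_def by (rule free_space_mod_norm_le[OF series_molecule_free[OF a]])
    also have "\<dots> \<le> vnorm l1 a" using series_molecule_norm[OF a] by (simp add: l1)
    finally show ?thesis .
  qed
  have Q_norm: "vnorm l1 (Q (?cos z)) \<le> C * vnorm ?M (?cos z)" if z: "z \<in> vecs ?F" for z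
  proof -
    have "vnorm l1 (Q (?cos z)) / C \<le> vnorm ?M (?cos z)"
    proof (rule free_space_mod_norm_ge)
      fix w assume w: "w \<in> ?cos z"
      have "vnorm l1 (Q (?cos z)) = (\<Sum>i. \<bar>w (unit_image i)\<bar>)"
        using in_coset[OF w] by (simp add: Q l1)
      also have "\<dots> \<le> C * vnorm ?F w" by (rule coefficients_l1(2)[OF free_coset_subset[OF z w]])
      finally show "vnorm l1 (Q (?cos z)) / C \<le> vnorm ?F w"
        using C_ge_1 by (simp add: pos_divide_le_eq mult.commute)
    qed
    then show ?thesis using C_ge_1 by (simp add: pos_divide_le_eq mult.commute)
  qed
  have "linear_op l1 ?M T"
    unfolding linear_op_def using T_mem T_add T_scale by blast
  moreover have "(1 / C) * vnorm l1 a \<le> vnorm ?M (T a)" if a: "a \<in> vecs l1" for a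
    using Q_norm[OF series_molecule_free[of a]] QT[OF a] a C_ge_1
    by (simp add: l1 T_def pos_divide_le_eq mult.commute)
  ultimately have "iso_embedding l1 ?M T"
    unfolding iso_embedding_def bounded_op_def using T_norm C_ge_1
    by (intro conjI exI[of _ 1] exI[of _ "1 / C"]) auto
  moreover have "bounded_op ?M ?M P"
    unfolding bounded_op_def linear_op_def
  proof (intro conjI funcsetI ballI allI exI[of _ C])
    show "P c \<in> vecs ?M" if "c \<in> vecs ?M" for c
      using that T_mem[OF Q_l1] by (auto simp: P_def free_space_mod_vecs)
    show "P (vadd ?M c d) = vadd ?M (P c) (P d)" if cd: "c \<in> vecs ?M" "d \<in> vecs ?M" for c d
    proof -
      obtain z w where z: "z \<in> vecs ?F" "c = ?cos z" and w: "w \<in> vecs ?F" "d = ?cos w"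
        using cd by (auto simp: free_space_mod_vecs)
      have "P (vadd ?M c d) = T (vadd l1 (Q (?cos z)) (Q (?cos w)))"
        by (simp add: P_def z(2) w(2) free_space_mod_add Q l1_ops)
      also have "\<dots> = vadd ?M (P c) (P d)"
        by (simp add: P_def z(2) w(2) T_add[OF Q_l1[OF z(1)] Q_l1[OF w(1)]])
      finally show ?thesis .
    qed
    show "P (vscale ?M r c) = vscale ?M r (P c)" if c: "c \<in> vecs ?M" for r c
    proof -
      obtain z where z: "z \<in> vecs ?F" "c = ?cos z" using c by (auto simp: free_space_mod_vecs)
      have "P (vscale ?M r c) = T (vscale l1 r (Q (?cos z)))"
        by (simp add: P_def z(2) free_space_mod_scale Q l1_ops)
      also have "\<dots> = vscale ?M r (P c)" by (simp add: P_def z(2) T_scale[OF Q_l1[OF z(1)]])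
      finally show ?thesis .
    qed
    show "vnorm ?M (P c) \<le> C * vnorm ?M c" if c: "c \<in> vecs ?M" for c
    proof -
      obtain z where z: "z \<in> vecs ?F" "c = ?cos z" using c by (auto simp: free_space_mod_vecs)
      show ?thesis
        unfolding P_def z(2) using T_norm[OF Q_l1[OF z(1)]] Q_norm[OF z(1)] by (rule order_trans)
    qed
  qed
  moreover have "P (P c) = P c" if "c \<in> vecs ?M" for c
    using that QT[OF Q_l1] by (auto simp: P_def free_space_mod_vecs)
  moreover have "P ` vecs ?M = T ` vecs l1"
  proof
    show "P ` vecs ?M \<subseteq> T ` vecs l1" using Q_l1 by (auto simp: P_def free_space_mod_vecs)
    show "T ` vecs l1 \<subseteq> P ` vecs ?M"
      using QT T_mem by (metis (no_types, lifting) P_def image_eqI image_subsetI)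
  qed
  ultimately show ?thesis unfolding contains_complemented_copy_def by blast
qed

end


theorem theorem4p5:
  fixes E :: "('v \<times> 'v) set"
    and v0 :: 'v
    and H :: "('v \<Rightarrow> 'v) set"
    and X :: "('v \<Rightarrow> real) set"
  assumes "sym E"
    and "connected_graph E"
    and "locally_finite_graph E"
    and "vertex_transitive E"
    and "infinite (UNIV :: 'v set)"
    and "subgroup H (aut_group E)"
    and "cocompact E H"
    and "linear_subspace (Lip0 E v0) X"
    and "pointwise_closed E v0 X"
    and "invariant_under v0 H X"
    and "X \<inter> Lip0_inf E v0 \<noteq> {\<lambda>_. 0}"
  shows "embeds_isomorphically linf (subspace_of (Lip0 E v0) X)
    \<and> \<not> separable_nspace (subspace_of (Lip0 E v0) X)
    \<and> contains_complemented_copy (free_space_mod E v0 X) l1"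
proof -
  obtain x y W C where "gradient_interpolation E v0 X x y W C"
    using exists_gradient_interpolation[OF assms] by blast
  then interpret gradient_interpolation E v0 X x y W C .
  show ?thesis using linf_embeds not_separable l1_complemented by blast
qed

end
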